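(* Let $G$ be a finitely generated sofic group with fixed finite symmetric generating set $S$, let $(G,\mathcal{X},\mu)$ be a $G$-process and let $(V_n,\sigma_n,\mu_n)$ be an ergodically sofic model for it. Let $\{H^{\omega}\}_{\omega\in\mathcal{X}^G}$ be a continuous operator over $\mathrm{Cay}(G,S)$ and assume that at least one of the following holds: (a) every map $\sigma_n:G\to\mathrm{Sym}(V_n)$ is a group homomorphism; (b) $\{H^\omega\}$ is of bounded interaction. Then for every induced approximation $(\{H_n^{\rho}\}_{\rho\in\mathcal X^{V_n}})_n$ of $\{H^{\omega}\}$, every $\varepsilon>0$ and every bounded continuous $f:\mathbb{R}\to\mathbb{R}$, \[\lim_{n\to\infty}\mu_n\big(\{\rho\in\mathcal{X}^{V_n}:\ |\vartheta_n^{\rho}(f)-N'(f)|<\varepsilon\}\big)=1.\]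
   Context: Sofic setting: $G$ is a finitely generated group with a fixed finite symmetric generating set $S\subseteq G\setminus\{e\}$ ($e$ the identity). $\mathrm{Cay}(G,S)$ has vertex set $G$, $x\sim y$ iff $y=sx$ for some $s\in S$, and the edge $(x,y)$ is labeled $yx^{-1}\in S$; $|g|_S$ is word length, $d_S(g,h)=|gh^{-1}|_S$, $B_S(g,R)=\{h:d_S(g,h)\le R\}$. A sofic approximation of $G$ is a sequence $(V_n,\sigma_n)$ of finite sets $V_n$ and maps $\sigma_n:G\to\mathrm{Sym}(V_n)$, $g\mapsto\sigma_n^g$, with $|\{v\in V_n:\sigma_n^g(\sigma_n^h(v))=\sigma_n^{gh}(v)\}|/|V_n|\to1$ for all $g,h\in G$ and $|\{v\in V_n:\sigma_n^g(v)\neq v\}|/|V_n|\to1$ for all $g\neq e$; $G$ is sofic if one exists. The associated $S$-labeled graph $(V_n,E_n)$ has $E_n=\{(v,\sigma_n^s(v)):v\in V_n,s\in S\}$, the edge $(v,\sigma_n^s(v))$ labeled $s$, path metric $d_{E_n}$ and balls $B_{E_n}(v,R)$. A vertex $v\in V_n$ is $R$-good if there is a label-preserving graph isomorphism from the induced subgraph $B_{E_n}(v,R)$ onto $B_S(e,R)$ sending $v$ to $e$. (For every $R$ the proportion of $R$-good vertices tends to $1$; for $R$-good $v$ and $w\in B_{E_n}(v,R)$ there is a unique $g$ with $|g|_S\le R$ and $\sigma_n^g(v)=w$.) Processes: $(\mathcal{X},d)$ is a compact metric space, $\mathcal{X}^G$ carries the product topology and the shift action $(h.\omega)(g)=\omega(gh)$.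 A $G$-process is $(G,\mathcal X,\mu)$ with $\mu$ a $G$-invariant Borel probability measure on $\mathcal X^G$; it is ergodic if $\mu$ is. For $\rho\in\mathcal X^{V_n}$, $v\in V_n$ let $\Pi_v^{\sigma_n}(\rho)=(\rho(\sigma_n^g(v)))_{g\in G}\in\mathcal X^G$ and $P^{\sigma_n}_\rho=\frac{1}{|V_n|}\sum_{v\in V_n}\delta_{\Pi_v^{\sigma_n}(\rho)}$. For $\mu_n\in\mathrm{Prob}(\mathcal X^{V_n})$, $\mu_n\to\mu$ locally weak* if for every weak* neighbourhood $\mathcal O$ of $\mu$, $|\{v\in V_n:(\Pi_v^{\sigma_n})_*\mu_n\in\mathcal O\}|/|V_n|\to1$, and locally and empirically (le) if in addition $\mu_n(\{\rho:P_\rho^{\sigma_n}\in\mathcal O\})\to 1$ for every such $\mathcal O$. $(V_n,\sigma_n,\mu_n)$ is a sofic model (resp. ergodically sofic model) if $(V_n,\sigma_n)$ is a sofic approximation and $\mu_n\to\mu$ locally weak* (resp. le). Operators: for a bounded operator $H$ on $\ell^2(V)$ write $H(x,y)=\langle\delta_x,H\delta_y\rangle$. A continuous operator over $\mathrm{Cay}(G,S)$ with parameter $M\in\mathbb N$ is a family $\{H^\omega\}_{\omega\in\mathcal X^G}$ of bounded operators on $\ell^2(G)$ such that: $\omega\mapsto H^\omega(x,y)$ is continuous for all $x,y$; each $H^\omega$ is self-adjoint; $H^\omega(x,y)=0$ whenever $d_S(x,y)>M$; and $H^\omega(xg,yg)=H^{g.\omega}(x,y)$ for all $x,y,g\in G$,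 $\omega$. It is of bounded interaction if $\omega_1|_{B_S(e,M)}=\omega_2|_{B_S(e,M)}$ implies $H^{\omega_1}(e,x)=H^{\omega_2}(e,x)$ for all $x\in G$. A weak approximation of it over $(V_n,\sigma_n)$ is a sequence of families $\{H_n^\rho\}_{\rho\in\mathcal X^{V_n}}$ of operators on $\ell^2(V_n)$ such that $\rho\mapsto H_n^\rho(x,y)$ is Borel; each $H_n^\rho$ is self-adjoint; $H_n^\rho(x,y)=0$ when $d_{E_n}(x,y)>M$; and for every $4M$-good $w\in V_n$, every $\rho$ and $v\in B_{E_n}(w,M)$, $H_n^\rho(w,v)=H^{\Pi_w^{\sigma_n}(\rho)}(e,g)$ where $g\in B_S(e,M)$ is the unique element with $\sigma_n^g(w)=v$. It is an induced approximation if moreover every $H_n^\rho(v,w)$ lies in $\{H^\omega(x,y):x,y\in G,\omega\in\mathcal X^G\}\cup\{0\}$. Spectral quantities: $E_H$ is the spectral measure of a self-adjoint $H$. $\vartheta_n^\rho(B)=\frac1{|V_n|}\sum_{v\in V_n}\langle\delta_v,E_{H_n^\rho}(B)\delta_v\rangle$, $\vartheta^\omega(B)=\langle\delta_e,E_{H^\omega}(B)\delta_e\rangle$, and $\vartheta(f)=\int f\,d\vartheta$. The density of states measure is $N'(f)=\int_{\mathcal X^G}\vartheta^\omega(f)\,d\mu(\omega)$. *)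

theory Defs
  imports "HOL-Analysis.Analysis" "HOL-Probability.Probability" "HOL-Algebra.Generated_Groups"
begin

definition fg_sym_group :: "('g, 'b) monoid_scheme \<Rightarrow> 'g set \<Rightarrow> bool" where
  "fg_sym_group G S \<longleftrightarrow> group G \<and> finite S \<and> S \<subseteq> carrier G \<and> \<one>\<^bsub>G\<^esub> \<notin> S \<and>
     (\<forall>s\<in>S. inv\<^bsub>G\<^esub> s \<in> S) \<and> generate G S = carrier G"

definition word_len :: "('g, 'b) monoid_scheme \<Rightarrow> 'g set \<Rightarrow> 'g \<Rightarrow> nat" where
  "word_len G S g = (LEAST n. \<exists>xs. length xs = n \<and> set xs \<subseteq> S \<and>
                         foldr (\<lambda>s a. s \<otimes>\<^bsub>G\<^esub> a) xs \<one>\<^bsub>G\<^esub> = g)"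

definition dS :: "('g, 'b) monoid_scheme \<Rightarrow> 'g set \<Rightarrow> 'g \<Rightarrow> 'g \<Rightarrow> nat" where
  "dS G S x y = word_len G S (x \<otimes>\<^bsub>G\<^esub> inv\<^bsub>G\<^esub> y)"

definition ballS :: "('g, 'b) monoid_scheme \<Rightarrow> 'g set \<Rightarrow> 'g \<Rightarrow> nat \<Rightarrow> 'g set" where
  "ballS G S g R = {h \<in> carrier G. dS G S g h \<le> R}"

definition sofic_approx :: "('g, 'b) monoid_scheme \<Rightarrow> (nat \<Rightarrow> 'v set) \<Rightarrow> (nat \<Rightarrow> 'g \<Rightarrow> 'v \<Rightarrow> 'v) \<Rightarrow> bool" where
  "sofic_approx G V \<sigma> \<longleftrightarrow>
     (\<forall>n. finite (V n)) \<and>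
     (\<forall>n. \<forall>g\<in>carrier G. \<sigma> n g permutes V n) \<and>
     (\<forall>g\<in>carrier G. \<forall>h\<in>carrier G.
        (\<lambda>n. real (card {v \<in> V n. \<sigma> n g (\<sigma> n h v) = \<sigma> n (g \<otimes>\<^bsub>G\<^esub> h) v}) / real (card (V n)))
          \<longlonglongrightarrow> 1) \<and>
     (\<forall>g\<in>carrier G. g \<noteq> \<one>\<^bsub>G\<^esub> \<longrightarrow>
        (\<lambda>n. real (card {v \<in> V n. \<sigma> n g v \<noteq> v}) / real (card (V n))) \<longlonglongrightarrow> 1)"

definition adjE :: "'g set \<Rightarrow> (nat \<Rightarrow> 'g \<Rightarrow> 'v \<Rightarrow> 'v) \<Rightarrow> nat \<Rightarrow> 'v \<Rightarrow> 'v \<Rightarrow> bool" where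
  "adjE S \<sigma> n v w \<longleftrightarrow> (\<exists>s\<in>S. w = \<sigma> n s v \<or> v = \<sigma> n s w)"

definition ballE :: "'g set \<Rightarrow> (nat \<Rightarrow> 'v set) \<Rightarrow> (nat \<Rightarrow> 'g \<Rightarrow> 'v \<Rightarrow> 'v) \<Rightarrow> nat \<Rightarrow> 'v \<Rightarrow> nat \<Rightarrow> 'v set" where
  "ballE S V \<sigma> n v R = {w \<in> V n. \<exists>k\<le>R. \<exists>p::nat \<Rightarrow> 'v. p 0 = v \<and> p k = w \<and>
        (\<forall>i\<le>k. p i \<in> V n) \<and> (\<forall>i<k. adjE S \<sigma> n (p i) (p (Suc i)))}"

definition good :: "('g, 'b) monoid_scheme \<Rightarrow> 'g set \<Rightarrow> (nat \<Rightarrow> 'v set) \<Rightarrow> (nat \<Rightarrow> 'g \<Rightarrow> 'v \<Rightarrow> 'v)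
                    \<Rightarrow> nat \<Rightarrow> nat \<Rightarrow> 'v \<Rightarrow> bool" where
  "good G S V \<sigma> n R v \<longleftrightarrow> v \<in> V n \<and>
     (\<exists>\<phi>. bij_betw \<phi> (ballE S V \<sigma> n v R) (ballS G S \<one>\<^bsub>G\<^esub> R) \<and> \<phi> v = \<one>\<^bsub>G\<^esub> \<and>
          (\<forall>u\<in>ballE S V \<sigma> n v R. \<forall>u'\<in>ballE S V \<sigma> n v R. \<forall>s\<in>S.
              u' = \<sigma> n s u \<longleftrightarrow> \<phi> u' = s \<otimes>\<^bsub>G\<^esub> \<phi> u))"

text \<open>\<open>\<X>^G\<close> as the extensional functions on the carrier, with the product topology / measure\<close>
definition XG :: "('g, 'b) monoid_scheme \<Rightarrow> ('g \<Rightarrow> 'x::topological_space) topology" where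
  "XG G = product_topology (\<lambda>_. euclidean) (carrier G)"

definition shift :: "('g, 'b) monoid_scheme \<Rightarrow> 'g \<Rightarrow> ('g \<Rightarrow> 'x) \<Rightarrow> ('g \<Rightarrow> 'x)" where
  "shift G h \<omega> = (\<lambda>g\<in>carrier G. \<omega> (g \<otimes>\<^bsub>G\<^esub> h))"

definition G_process :: "('g, 'b) monoid_scheme \<Rightarrow> ('g \<Rightarrow> 'x::topological_space) measure \<Rightarrow> bool" where
  "G_process G \<mu> \<longleftrightarrow> prob_space \<mu> \<and> sets \<mu> = sets (PiM (carrier G) (\<lambda>_. borel)) \<and>
      (\<forall>h\<in>carrier G. distr \<mu> (PiM (carrier G) (\<lambda>_. borel)) (shift G h) = \<mu>)"

definition PiV :: "('g, 'b) monoid_scheme \<Rightarrow> (nat \<Rightarrow> 'g \<Rightarrow> 'v \<Rightarrow> 'v) \<Rightarrow> nat \<Rightarrow> 'v \<Rightarrow> ('v \<Rightarrow> 'x) \<Rightarrow> ('g \<Rightarrow> 'x)" where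
  "PiV G \<sigma> n v \<rho> = (\<lambda>g\<in>carrier G. \<rho> (\<sigma> n g v))"

text \<open>Local weak* convergence, written out with basic weak* neighbourhoods
  \<open>{\<nu>. \<forall>f\<in>F. |\<nu>(f) - \<mu>(f)| < \<epsilon>}\<close>, \<open>F\<close> a finite set of continuous functions.\<close>
definition loc_weak :: "('g, 'b) monoid_scheme \<Rightarrow> (nat \<Rightarrow> 'v set) \<Rightarrow> (nat \<Rightarrow> 'g \<Rightarrow> 'v \<Rightarrow> 'v)
     \<Rightarrow> (nat \<Rightarrow> ('v \<Rightarrow> 'x::topological_space) measure) \<Rightarrow> ('g \<Rightarrow> 'x) measure \<Rightarrow> bool" where
  "loc_weak G V \<sigma> \<mu>s \<mu> \<longleftrightarrow>
     (\<forall>F \<epsilon>. finite F \<and> (\<forall>f\<in>F. continuous_map (XG G) euclideanreal f) \<and> \<epsilon> > 0 \<longrightarrow>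
        (\<lambda>n. real (card {v \<in> V n. \<forall>f\<in>F.
               \<bar>(\<integral>\<rho>. f (PiV G \<sigma> n v \<rho>) \<partial>\<mu>s n) - (\<integral>\<omega>. f \<omega> \<partial>\<mu>)\<bar> < \<epsilon>}) / real (card (V n)))
          \<longlonglongrightarrow> 1)"

definition loc_emp :: "('g, 'b) monoid_scheme \<Rightarrow> (nat \<Rightarrow> 'v set) \<Rightarrow> (nat \<Rightarrow> 'g \<Rightarrow> 'v \<Rightarrow> 'v)
     \<Rightarrow> (nat \<Rightarrow> ('v \<Rightarrow> 'x::topological_space) measure) \<Rightarrow> ('g \<Rightarrow> 'x) measure \<Rightarrow> bool" where
  "loc_emp G V \<sigma> \<mu>s \<mu> \<longleftrightarrow> loc_weak G V \<sigma> \<mu>s \<mu> \<and>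
     (\<forall>F \<epsilon>. finite F \<and> (\<forall>f\<in>F. continuous_map (XG G) euclideanreal f) \<and> \<epsilon> > 0 \<longrightarrow>
        (\<lambda>n. measure (\<mu>s n) {\<rho> \<in> space (\<mu>s n). \<forall>f\<in>F.
               \<bar>(\<Sum>v\<in>V n. f (PiV G \<sigma> n v \<rho>)) / real (card (V n)) - (\<integral>\<omega>. f \<omega> \<partial>\<mu>)\<bar> < \<epsilon>})
          \<longlonglongrightarrow> 1)"

definition ergodically_sofic_model :: "('g, 'b) monoid_scheme \<Rightarrow> (nat \<Rightarrow> 'v set) \<Rightarrow> (nat \<Rightarrow> 'g \<Rightarrow> 'v \<Rightarrow> 'v)
     \<Rightarrow> (nat \<Rightarrow> ('v \<Rightarrow> 'x::topological_space) measure) \<Rightarrow> ('g \<Rightarrow> 'x) measure \<Rightarrow> bool" where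
  "ergodically_sofic_model G V \<sigma> \<mu>s \<mu> \<longleftrightarrow> sofic_approx G V \<sigma> \<and>
     (\<forall>n. prob_space (\<mu>s n) \<and> sets (\<mu>s n) = sets (PiM (V n) (\<lambda>_. borel))) \<and>
     loc_emp G V \<sigma> \<mu>s \<mu>"

section \<open>Operators given by matrix kernels \<open>H(x,y) = \<langle>\<delta>_x, H \<delta>_y\<rangle>\<close> on \<open>\<ell>^2(A)\<close>\<close>

definition bounded_kernel :: "'a set \<Rightarrow> ('a \<Rightarrow> 'a \<Rightarrow> complex) \<Rightarrow> bool" where
  "bounded_kernel A K \<longleftrightarrow> (\<exists>C. \<forall>F D (v::'a \<Rightarrow> complex). finite F \<and> F \<subseteq> A \<and> finite D \<and> D \<subseteq> A \<longrightarrow>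
      (\<Sum>x\<in>D. (cmod (\<Sum>y\<in>F. K x y * v y))\<^sup>2) \<le> C * (\<Sum>y\<in>F. (cmod (v y))\<^sup>2))"

definition selfadjoint_kernel :: "'a set \<Rightarrow> ('a \<Rightarrow> 'a \<Rightarrow> complex) \<Rightarrow> bool" where
  "selfadjoint_kernel A K \<longleftrightarrow> bounded_kernel A K \<and> (\<forall>x\<in>A. \<forall>y\<in>A. K y x = cnj (K x y))"

definition kmult :: "'a set \<Rightarrow> ('a \<Rightarrow> 'a \<Rightarrow> complex) \<Rightarrow> ('a \<Rightarrow> 'a \<Rightarrow> complex) \<Rightarrow> 'a \<Rightarrow> 'a \<Rightarrow> complex" where
  "kmult A K L = (\<lambda>x z. infsum (\<lambda>y. K x y * L y z) A)"

fun kpow :: "'a set \<Rightarrow> ('a \<Rightarrow> 'a \<Rightarrow> complex) \<Rightarrow> nat \<Rightarrow> 'a \<Rightarrow> 'a \<Rightarrow> complex" where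
  "kpow A K 0 = (\<lambda>x y. if x = y then 1 else 0)"
| "kpow A K (Suc k) = kmult A K (kpow A K k)"

text \<open>The spectral measure \<open>\<langle>\<delta>_x, E_K(\<cdot>) \<delta>_x\<rangle>\<close> of a bounded self-adjoint operator:
  the (unique, compactly supported) Borel probability measure on the reals whose moments
  are \<open>\<langle>\<delta>_x, K^k \<delta>_x\<rangle>\<close>.\<close>
definition spec_meas :: "'a set \<Rightarrow> ('a \<Rightarrow> 'a \<Rightarrow> complex) \<Rightarrow> 'a \<Rightarrow> real measure" where
  "spec_meas A K x = (THE \<nu>. sets \<nu> = sets borel \<and> prob_space \<nu> \<and>
      (\<forall>k::nat. integrable \<nu> (\<lambda>t. t ^ k) \<and> (\<integral>t. t ^ k \<partial>\<nu>) = Re (kpow A K k x x)))"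

definition continuous_operator :: "('g, 'b) monoid_scheme \<Rightarrow> 'g set \<Rightarrow> nat
     \<Rightarrow> (('g \<Rightarrow> 'x::topological_space) \<Rightarrow> 'g \<Rightarrow> 'g \<Rightarrow> complex) \<Rightarrow> bool" where
  "continuous_operator G S M H \<longleftrightarrow>
     (\<forall>x\<in>carrier G. \<forall>y\<in>carrier G. continuous_map (XG G) euclidean (\<lambda>\<omega>. H \<omega> x y)) \<and>
     (\<forall>\<omega>\<in>topspace (XG G). selfadjoint_kernel (carrier G) (H \<omega>)) \<and>
     (\<forall>\<omega>\<in>topspace (XG G). \<forall>x\<in>carrier G. \<forall>y\<in>carrier G. dS G S x y > M \<longrightarrow> H \<omega> x y = 0) \<and>
     (\<forall>\<omega>\<in>topspace (XG G). \<forall>x\<in>carrier G. \<forall>y\<in>carrier G. \<forall>g\<in>carrier G.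
          H \<omega> (x \<otimes>\<^bsub>G\<^esub> g) (y \<otimes>\<^bsub>G\<^esub> g) = H (shift G g \<omega>) x y)"

definition bounded_interaction :: "('g, 'b) monoid_scheme \<Rightarrow> 'g set \<Rightarrow> nat
     \<Rightarrow> (('g \<Rightarrow> 'x::topological_space) \<Rightarrow> 'g \<Rightarrow> 'g \<Rightarrow> complex) \<Rightarrow> bool" where
  "bounded_interaction G S M H \<longleftrightarrow>
     (\<forall>\<omega>1\<in>topspace (XG G). \<forall>\<omega>2\<in>topspace (XG G).
        (\<forall>g\<in>ballS G S \<one>\<^bsub>G\<^esub> M. \<omega>1 g = \<omega>2 g) \<longrightarrow> (\<forall>x\<in>carrier G. H \<omega>1 \<one>\<^bsub>G\<^esub> x = H \<omega>2 \<one>\<^bsub>G\<^esub> x))"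

definition weak_approx :: "('g, 'b) monoid_scheme \<Rightarrow> 'g set \<Rightarrow> (nat \<Rightarrow> 'v set) \<Rightarrow> (nat \<Rightarrow> 'g \<Rightarrow> 'v \<Rightarrow> 'v)
     \<Rightarrow> nat \<Rightarrow> (('g \<Rightarrow> 'x::topological_space) \<Rightarrow> 'g \<Rightarrow> 'g \<Rightarrow> complex)
     \<Rightarrow> (nat \<Rightarrow> ('v \<Rightarrow> 'x) \<Rightarrow> 'v \<Rightarrow> 'v \<Rightarrow> complex) \<Rightarrow> bool" where
  "weak_approx G S V \<sigma> M H Hn \<longleftrightarrow> (\<forall>n.
     (\<forall>x\<in>V n. \<forall>y\<in>V n. (\<lambda>\<rho>. Hn n \<rho> x y) \<in> borel_measurable (PiM (V n) (\<lambda>_. borel))) \<and>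
     (\<forall>\<rho>\<in>space (PiM (V n) (\<lambda>_. borel)). selfadjoint_kernel (V n) (Hn n \<rho>)) \<and>
     (\<forall>\<rho>\<in>space (PiM (V n) (\<lambda>_. borel)). \<forall>x\<in>V n. \<forall>y\<in>V n.
         y \<notin> ballE S V \<sigma> n x M \<longrightarrow> Hn n \<rho> x y = 0) \<and>
     (\<forall>w. good G S V \<sigma> n (4 * M) w \<longrightarrow>
        (\<forall>\<rho>\<in>space (PiM (V n) (\<lambda>_. borel)). \<forall>v\<in>ballE S V \<sigma> n w M. \<forall>g\<in>carrier G.
           word_len G S g \<le> M \<and> \<sigma> n g w = v \<longrightarrow> Hn n \<rho> w v = H (PiV G \<sigma> n w \<rho>) \<one>\<^bsub>G\<^esub> g)))"

definition induced_approx :: "('g, 'b) monoid_scheme \<Rightarrow> 'g set \<Rightarrow> (nat \<Rightarrow> 'v set) \<Rightarrow> (nat \<Rightarrow> 'g \<Rightarrow> 'v \<Rightarrow> 'v)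
     \<Rightarrow> nat \<Rightarrow> (('g \<Rightarrow> 'x::topological_space) \<Rightarrow> 'g \<Rightarrow> 'g \<Rightarrow> complex)
     \<Rightarrow> (nat \<Rightarrow> ('v \<Rightarrow> 'x) \<Rightarrow> 'v \<Rightarrow> 'v \<Rightarrow> complex) \<Rightarrow> bool" where
  "induced_approx G S V \<sigma> M H Hn \<longleftrightarrow> weak_approx G S V \<sigma> M H Hn \<and>
     (\<forall>n. \<forall>\<rho>\<in>space (PiM (V n) (\<lambda>_. borel)). \<forall>v\<in>V n. \<forall>w\<in>V n.
        Hn n \<rho> v w \<in> {H \<omega> x y | \<omega> x y. \<omega> \<in> topspace (XG G) \<and> x \<in> carrier G \<and> y \<in> carrier G} \<union> {0})"

definition theta_n :: "(nat \<Rightarrow> 'v set) \<Rightarrow> (nat \<Rightarrow> ('v \<Rightarrow> 'x) \<Rightarrow> 'v \<Rightarrow> 'v \<Rightarrow> complex) \<Rightarrow> nat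
     \<Rightarrow> ('v \<Rightarrow> 'x) \<Rightarrow> (real \<Rightarrow> real) \<Rightarrow> real" where
  "theta_n V Hn n \<rho> f = (\<Sum>v\<in>V n. \<integral>t. f t \<partial>(spec_meas (V n) (Hn n \<rho>) v)) / real (card (V n))"

definition theta :: "('g, 'b) monoid_scheme \<Rightarrow> (('g \<Rightarrow> 'x) \<Rightarrow> 'g \<Rightarrow> 'g \<Rightarrow> complex)
     \<Rightarrow> ('g \<Rightarrow> 'x) \<Rightarrow> (real \<Rightarrow> real) \<Rightarrow> real" where
  "theta G H \<omega> f = (\<integral>t. f t \<partial>(spec_meas (carrier G) (H \<omega>) \<one>\<^bsub>G\<^esub>))"

definition IDS :: "('g, 'b) monoid_scheme \<Rightarrow> (('g \<Rightarrow> 'x) \<Rightarrow> 'g \<Rightarrow> 'g \<Rightarrow> complex)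
     \<Rightarrow> ('g \<Rightarrow> 'x) measure \<Rightarrow> (real \<Rightarrow> real) \<Rightarrow> real" where
  "IDS G H \<mu> f = (\<integral>\<omega>. theta G H \<omega> f \<partial>\<mu>)"

end

(*
  Every function f in sight is integrated against spectral measures supported in one fixed
  interval [-C, C], because the entries of all operators are uniformly bounded (compactness) and
  their rows have uniformly bounded support. So f may be replaced by a polynomial p, for which
  theta_n(p) is an average of diagonal entries of p(H_n). At a vertex v around which sigma_n behaves
  like the group, which is asymptotically almost every v, this entry equals the diagonal entry at e of
  p(H^omega) with omega = Pi_v(rho), a continuous function of omega; empirical convergence finishes
  the proof.

  The spectral measures are obtained without a spectral theorem. A bounded self-adjoint kernel makes
  p |-> <delta_x, p(K) delta_x> nonnegative on the products (C + t)^k (C - t)^l, and Hausdorff's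
  solution of the moment problem (Bernstein weights plus Helly selection) turns this into a measure.
*)
theory Submission
  imports Defs "HOL-Computational_Algebra.Polynomial"
begin

text \<open>The alternative in the hypotheses settles one comparison. At the vertex sigma_g(v) the
  finite operator reads the configuration h |-> rho(sigma_h(sigma_g(v))), whereas equivariance of H
  asks for h |-> rho(sigma_{hg}(v)). For homomorphisms the two coincide; otherwise they agree near a
  typical v only for h in a ball fixed in advance, and bounded interaction says that the ball of
  radius M is all that H sees. The condition on entries of an induced approximation controls the
  exceptional vertices: the bound B holds there too, so each of them changes a polynomial average by
  at most a constant over |V_n|. \<open>spec_meas\<close> is a definite description through moments.
  Hence a measure with the moments <delta_x, K^k delta_x> has to be produced, and it has to be
  unique among all measures with these moments. This description does not show how the measure
  depends on omega or rho, so measurability of its integrals is obtained by passing to limits of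
  polynomial expressions.\<close>

section \<open>Moment problems on compact intervals\<close>

text \<open>A factorial moment of the binomial distribution: (n choose k)(k choose m) = (n choose
  m)(n-m choose k-m) pulls out x^m, and what remains is (x + (1 - x))^(n-m). The setting is a
  commutative ring because x will be the polynomial X, before a functional is applied.\<close>

lemma bernstein_choose_moment:
  fixes x :: "'a::comm_ring_1"
  assumes "m \<le> n"
  shows "(\<Sum>k\<le>n. of_nat ((n choose k) * (k choose m)) * (x ^ k * (1 - x) ^ (n - k)))
           = of_nat (n choose m) * x ^ m"
proof -
  let ?g = "\<lambda>k. of_nat ((n choose k) * (k choose m)) * (x ^ k * (1 - x) ^ (n - k))"
  have "(\<Sum>k\<le>n. ?g k) = (\<Sum>k\<in>{m..n}. ?g k)"
    by (rule sum.mono_neutral_right) (auto simp: binomial_eq_0)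
  also have "\<dots> = (\<Sum>j\<le>n - m. ?g (j + m))"
    using sum.shift_bounds_cl_nat_ivl[of ?g 0 m "n - m"] assms by (simp add: atMost_atLeast0)
  also have "\<dots> = (\<Sum>j\<le>n - m. of_nat (n choose m) * x ^ m
                     * (of_nat ((n - m) choose j) * x ^ j * (1 - x) ^ (n - m - j)))"
  proof (rule sum.cong)
    fix j assume "j \<in> {..n - m}"
    then have "(n choose (j + m)) * ((j + m) choose m) = (n choose m) * ((n - m) choose j)"
      using choose_mult[of m "j + m" n] assms by simp
    then show "?g (j + m) = of_nat (n choose m) * x ^ m
                     * (of_nat ((n - m) choose j) * x ^ j * (1 - x) ^ (n - m - j))"
      by (simp only: of_nat_mult power_add diff_diff_left add.commute[of m j]) (simp add: algebra_simps)
  qed simp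
  also have "\<dots> = of_nat (n choose m) * x ^ m * (x + (1 - x)) ^ (n - m)"
    by (simp only: binomial_ring sum_distrib_left)
  finally show ?thesis by simp
qed

text \<open>The falling factorial that stands in for k^m below; for k < m both sides vanish.\<close>

lemma fact_times_binomial: "fact m * real (k choose m) = (\<Prod>j<m. real k - real j)"
  by (simp add: binomial_gbinomial gbinomial_prod_rev lessThan_atLeast0)

text \<open>The Bernstein weights of L, placed at the points k/n, have factorial moments that are
  exact multiples of L(X^m). Factorial and ordinary moments differ by O(1/n), so a weak limit along
  a subsequence has the moments prescribed by L.\<close>

theorem hausdorff_moment_problem:
  fixes L :: "real poly \<Rightarrow> real"
  assumes add: "\<And>p q. L (p + q) = L p + L q" and scale: "\<And>c p. L (smult c p) = c * L p"
    and one: "L 1 = 1" and pos: "\<And>k l. L ([:0, 1:] ^ k * [:1, -1:] ^ l) \<ge> 0"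
  obtains \<nu> where "real_distribution \<nu>" "AE t in \<nu>. t \<in> {0..1}" "\<And>p. (\<integral>t. poly p t \<partial>\<nu>) = L p"
proof -
  have L_0: "L 0 = 0" using scale[of 0 0] by simp
  have L_sum: "L (\<Sum>i\<in>I. h i) = (\<Sum>i\<in>I. L (h i))" for I :: "nat set" and h
    by (induction I rule: infinite_finite_induct) (auto simp: L_0 add)
  have L_of_nat: "L (of_nat c * p) = real c * L p" for c p
    using scale[of "real c" p] by (simp add: of_nat_poly)
  \<comment> \<open>L of the k-th Bernstein polynomial of degree n: nonnegative by
    \<open>pos\<close>, of total mass 1 by \<open>w_choose\<close> with m = 0. The value 0 beyond n
    makes it a mass function on all naturals.\<close>
  define w where "w n k = (if k \<le> n then real (n choose k) * L ([:0, 1:] ^ k * [:1, -1:] ^ (n - k)) else 0)"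
    for n k
  have w_nonneg: "w n k \<ge> 0" for n k by (simp add: w_def pos)
  have x': "1 - [:0, 1:] = ([:1, -1:] :: real poly)" by (simp add: one_pCons)
  have w_choose: "(\<Sum>k\<le>n. w n k * real (k choose m)) = real (n choose m) * L ([:0, 1:] ^ m)" if "m \<le> n" for n m
  proof -
    have "(\<Sum>k\<le>n. w n k * real (k choose m))
      = L (\<Sum>k\<le>n. of_nat ((n choose k) * (k choose m)) * ([:0, 1:] ^ k * (1 - [:0, 1:]) ^ (n - k)))"
      unfolding L_sum L_of_nat x' by (intro sum.cong) (auto simp: w_def)
    also have "\<dots> = real (n choose m) * L ([:0, 1:] ^ m)"
      unfolding bernstein_choose_moment[OF that] L_of_nat ..
    finally show ?thesis .
  qed
  have w_sum: "(\<Sum>k\<le>n. w n k) = 1" for n using w_choose[of 0 n] one by simp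
  \<comment> \<open>Degree \<open>Suc n\<close> keeps the atoms k / \<open>Suc n\<close> free of
    division by zero.\<close>
  define P where "P n = embed_pmf (w (Suc n))" for n
  have pmf_P: "pmf (P n) k = w (Suc n) k" for n k
    unfolding P_def
  proof (rule pmf_embed_pmf)
    have "(\<integral>\<^sup>+k. ennreal (w (Suc n) k) \<partial>count_space UNIV)
       = (\<integral>\<^sup>+k. ennreal (w (Suc n) k) \<partial>count_space {..Suc n})"
      by (rule nn_integral_count_space_eq) (auto simp: w_def)
    also have "\<dots> = 1"
      by (simp add: nn_integral_count_space_finite sum_ennreal w_nonneg w_sum del: sum.atMost_Suc)
    finally show "(\<integral>\<^sup>+k. ennreal (w (Suc n) k) \<partial>count_space UNIV) = 1" .
  qed (simp add: w_nonneg)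
  have set_P: "set_pmf (P n) \<subseteq> {..Suc n}" for n
    by (auto simp: set_pmf_eq pmf_P w_def)
  have E_P: "measure_pmf.expectation (P n) h = (\<Sum>k\<le>Suc n. w (Suc n) k * h k)" for n and h :: "nat \<Rightarrow> real"
    using set_P by (subst integral_measure_pmf_real[of "{..Suc n}"]) (auto simp: pmf_P mult.commute)
  define \<nu> where "\<nu> n = distr (measure_pmf (P n)) borel (\<lambda>k. real k / real (Suc n))" for n
  have rd: "real_distribution (\<nu> n)" for n
    unfolding \<nu>_def by (intro prob_space.real_distribution_distr[OF prob_space_measure_pmf]) simp
  have AE_\<nu>: "AE t in \<nu> n. t \<in> {0..1}" for n
    unfolding \<nu>_def using set_P[of n]
    by (subst AE_distr_iff) (auto simp: AE_measure_pmf_iff field_simps simp flip: of_nat_Suc)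
  have E_\<nu>: "integral\<^sup>L (\<nu> n) h = (\<Sum>k\<le>Suc n. w (Suc n) k * h (real k / real (Suc n)))"
    if "h \<in> borel_measurable borel" for n and h :: "real \<Rightarrow> real"
    unfolding \<nu>_def using that by (subst integral_distr) (auto simp: E_P simp del: sum.atMost_Suc)
  have moment_lim: "(\<lambda>n. integral\<^sup>L (\<nu> n) (\<lambda>t. t ^ m)) \<longlonglongrightarrow> L ([:0, 1:] ^ m)" for m
  proof -
    \<comment> \<open>At t = k / \<open>Suc n\<close> this is a rescaled falling factorial of k, so
      \<open>w_choose\<close> evaluates its integral exactly; it differs from t^m by lower-order
      terms.\<close>
    let ?q = "\<lambda>n t. \<Prod>j<m. t - real j / real (Suc n)"
    have q: "integral\<^sup>L (\<nu> n) (?q n) = (\<Prod>j<m. 1 - real j / real (Suc n)) * L ([:0, 1:] ^ m)"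
      if "m \<le> Suc n" for n
    proof -
      have pr: "(\<Prod>j<m. real k / real (Suc n) - real j / real (Suc n)) = fact m * real (k choose m) / real (Suc n) ^ m" for k
        unfolding fact_times_binomial by (simp add: diff_divide_distrib[symmetric] prod_dividef)
      have "integral\<^sup>L (\<nu> n) (?q n)
          = (\<Sum>k\<le>Suc n. w (Suc n) k * real (k choose m)) * (fact m / real (Suc n) ^ m)"
        by (subst E_\<nu>) (simp_all add: pr sum_distrib_right sum_distrib_left mult_ac del: sum.atMost_Suc of_nat_Suc)
      also have "\<dots> = (fact m * real (Suc n choose m) / real (Suc n) ^ m) * L ([:0, 1:] ^ m)"
        unfolding w_choose[OF that] by simp
      also have "fact m * real (Suc n choose m) / real (Suc n) ^ m = (\<Prod>j<m. 1 - real j / real (Suc n))"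
        using pr[of "Suc n"] by simp
      finally show ?thesis .
    qed
    have "(\<lambda>n. integral\<^sup>L (\<nu> n) (\<lambda>t. t ^ m) - integral\<^sup>L (\<nu> n) (?q n)) \<longlonglongrightarrow> 0"
    proof (rule Lim_null_comparison)
      show "(\<lambda>n. (\<Sum>j<m. real j / real (Suc n))) \<longlonglongrightarrow> 0"
        by (intro tendsto_null_sum LIMSEQ_Suc[OF lim_const_over_n])
      show "\<forall>\<^sub>F n in sequentially. norm (integral\<^sup>L (\<nu> n) (\<lambda>t. t ^ m) - integral\<^sup>L (\<nu> n) (?q n))
             \<le> (\<Sum>j<m. real j / real (Suc n))"
        using eventually_ge_at_top[of m]
      proof eventually_elim
        case (elim n)
        let ?B = "\<Sum>j<m. real j / real (Suc n)"
        have *: "\<bar>(real k / real (Suc n)) ^ m - ?q n (real k / real (Suc n))\<bar> \<le> ?B" if "k \<le> Suc n" for k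
        proof -
          \<comment> \<open>Products of factors of modulus at most 1 differ by at most the sum of
            the differences of the factors. The shifted factors stay in [-1, 1] because j < m and m
            is at most n.\<close>
          have "norm ((\<Prod>j<m. real k / real (Suc n)) - (\<Prod>j<m. real k / real (Suc n) - real j / real (Suc n)))
             \<le> (\<Sum>j<m. norm (real k / real (Suc n) - (real k / real (Suc n) - real j / real (Suc n))))"
          proof (rule norm_prod_diff)
            fix j assume "j \<in> {..<m}"
            then have "real j \<le> real (Suc n)" "real k \<le> real (Suc n)" using elim that by auto
            then show "norm (real k / real (Suc n) - real j / real (Suc n)) \<le> 1"
              unfolding diff_divide_distrib[symmetric] by (simp add: abs_le_iff field_simps)
          qed (use that in simp)
          then show ?thesis by simp
        qed
        have "norm (integral\<^sup>L (\<nu> n) (\<lambda>t. t ^ m) - integral\<^sup>L (\<nu> n) (?q n))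
            = \<bar>\<Sum>k\<le>Suc n. w (Suc n) k * ((real k / real (Suc n)) ^ m - ?q n (real k / real (Suc n)))\<bar>"
          by (subst (1 2) E_\<nu>) (simp_all add: sum_subtractf[symmetric] right_diff_distrib del: sum.atMost_Suc of_nat_Suc)
        also have "\<dots> \<le> (\<Sum>k\<le>Suc n. w (Suc n) k * ?B)"
          by (rule order_trans[OF sum_abs], intro sum_mono, unfold abs_mult)
            (use * w_nonneg in \<open>auto intro!: mult_mono simp del: of_nat_Suc\<close>)
        also have "\<dots> = ?B" unfolding sum_distrib_right[symmetric] w_sum by simp
        finally show ?case .
      qed
    qed
    moreover have "(\<lambda>n. integral\<^sup>L (\<nu> n) (?q n)) \<longlonglongrightarrow> L ([:0, 1:] ^ m)"
    proof (rule Lim_transform_eventually)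
      have "(\<lambda>n. (\<Prod>j<m. 1 - real j / real (Suc n)) * L ([:0, 1:] ^ m)) \<longlonglongrightarrow> (\<Prod>j<m. 1 - 0) * L ([:0, 1:] ^ m)"
        by (intro tendsto_intros LIMSEQ_Suc[OF lim_const_over_n])
      then show "(\<lambda>n. (\<Prod>j<m. 1 - real j / real (Suc n)) * L ([:0, 1:] ^ m)) \<longlonglongrightarrow> L ([:0, 1:] ^ m)" by simp
      show "\<forall>\<^sub>F n in sequentially. (\<Prod>j<m. 1 - real j / real (Suc n)) * L ([:0, 1:] ^ m) = integral\<^sup>L (\<nu> n) (?q n)"
        using eventually_ge_at_top[of m] by eventually_elim (simp add: q del: of_nat_Suc)
    qed
    ultimately show ?thesis using tendsto_add by fastforce
  qed
  have "tight \<nu>"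
    unfolding tight_def
  proof (intro conjI allI impI)
    fix \<epsilon> :: real assume "\<epsilon> > 0"
    \<comment> \<open>Tightness is phrased with half-open intervals; the left end -1 keeps a
      possible atom at 0 inside.\<close>
    have "measure (\<nu> n) {-1<..1} = 1" for n
    proof -
      interpret real_distribution "\<nu> n" by (rule rd)
      show ?thesis using AE_\<nu>[of n] by (subst prob_eq_1) auto
    qed
    then show "\<exists>a b. a < b \<and> (\<forall>n. 1 - \<epsilon> < measure (\<nu> n) {a<..b})"
      using \<open>\<epsilon> > 0\<close> by (intro exI[of _ "-1"] exI[of _ 1]) auto
  qed (rule rd)
  then obtain r N where r: "strict_mono r" and N: "real_distribution N" and "weak_conv_m (\<nu> \<circ> id \<circ> r) N"
    using tight_imp_convergent_subsubsequence[of \<nu> id] by (auto simp: strict_mono_id)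
  then have wc: "weak_conv_m (\<nu> \<circ> r) N" by simp
  interpret N: real_distribution N by (rule N)
  \<comment> \<open>Weak convergence tests bounded continuous functions only, so powers are taken
    after clamping to [0, 1], which changes nothing on the support of each \<open>\<nu> n\<close>.
    The image of the limit under \<open>c\<close> then lies in [0, 1] by construction.\<close>
  define c where "c t = max 0 (min 1 t)" for t :: real
  have c_range: "c t \<in> {0..1}" for t by (auto simp: c_def)
  have c_meas [measurable]: "c \<in> borel_measurable borel" unfolding c_def by measurable
  have E_N: "(\<integral>t. c t ^ m \<partial>N) = L ([:0, 1:] ^ m)" for m
  proof (rule LIMSEQ_unique)
    interpret nr: real_distribution "(\<nu> \<circ> r) n" for n using rd by simp
    show "(\<lambda>n. integral\<^sup>L ((\<nu> \<circ> r) n) (\<lambda>t. c t ^ m)) \<longlonglongrightarrow> (\<integral>t. c t ^ m \<partial>N)"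
    proof (rule weak_conv_imp_integral_bdd_continuous_conv[OF _ N wc])
      show "real_distribution ((\<nu> \<circ> r) n)" for n using rd by simp
      show "isCont (\<lambda>t. c t ^ m) x" for x unfolding c_def by (intro continuous_intros)
      show "norm (c t ^ m) \<le> 1" for t using c_range[of t] by (auto simp: power_le_one norm_power)
    qed
    have "(\<lambda>n. integral\<^sup>L (\<nu> (r n)) (\<lambda>t. t ^ m)) \<longlonglongrightarrow> L ([:0, 1:] ^ m)"
      using LIMSEQ_subseq_LIMSEQ[OF moment_lim r] by (simp add: o_def)
    moreover have "integral\<^sup>L (\<nu> (r n)) (\<lambda>t. t ^ m) = integral\<^sup>L ((\<nu> \<circ> r) n) (\<lambda>t. c t ^ m)" for n
      unfolding o_def
    proof (rule integral_cong_AE)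
      show "AE t in \<nu> (r n). t ^ m = c t ^ m"
        using AE_\<nu>[of "r n"] by eventually_elim (simp add: c_def)
    qed (use rd in \<open>auto simp: \<nu>_def\<close>)
    ultimately show "(\<lambda>n. integral\<^sup>L ((\<nu> \<circ> r) n) (\<lambda>t. c t ^ m)) \<longlonglongrightarrow> L ([:0, 1:] ^ m)" by simp
  qed
  show ?thesis
  proof
    show "real_distribution (distr N borel c)" by (rule N.real_distribution_distr) simp
    show "AE t in distr N borel c. t \<in> {0..1}"
      using c_range by (subst AE_distr_iff) auto
    fix p
    have int: "integrable N (\<lambda>t. c t ^ m)" for m
    proof (rule N.integrable_const_bound[where B = 1])
      show "AE t in N. norm (c t ^ m) \<le> 1" using c_range by (auto simp: power_le_one norm_power)
    qed simp
    have "(\<integral>t. poly p t \<partial>distr N borel c) = (\<integral>t. poly p (c t) \<partial>N)"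
      by (intro integral_distr borel_measurable_continuous_onI continuous_intros) simp
    also have "\<dots> = (\<Sum>i\<le>degree p. coeff p i * L ([:0, 1:] ^ i))"
      unfolding poly_altdef using int by (simp add: E_N)
    also have "\<dots> = L (\<Sum>i\<le>degree p. monom (coeff p i) i)"
      unfolding L_sum monom_altdef scale ..
    finally show "(\<integral>t. poly p t \<partial>distr N borel c) = L p" by (simp add: poly_as_sum_of_monoms)
  qed
qed

text \<open>The substitution t = 2 C s - C carries [0, 1] to [-C, C]. Its inverse \<open>u\<close>
  turns s and 1 - s into positive multiples of C + t and C - t, so positivity transfers.\<close>

corollary moment_problem_interval:
  fixes L :: "real poly \<Rightarrow> real"
  assumes add: "\<And>p q. L (p + q) = L p + L q" and scale: "\<And>c p. L (smult c p) = c * L p"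
    and one: "L 1 = 1" and "C > 0" and pos: "\<And>k l. L ([:C, 1:] ^ k * [:C, -1:] ^ l) \<ge> 0"
  obtains \<nu> where "real_distribution \<nu>" "AE t in \<nu>. \<bar>t\<bar> \<le> C" "\<And>p. (\<integral>t. poly p t \<partial>\<nu>) = L p"
proof -
  define u where "u = [:1/2, 1/(2*C):]"
  have u: "u = smult (1/(2*C)) [:C, 1:]" "1 - u = smult (1/(2*C)) [:C, -1:]"
    using \<open>C > 0\<close> by (simp_all add: u_def one_pCons)
  define L' where "L' p = L (pcompose p u)" for p
  have pos': "L' ([:0, 1:] ^ k * [:1, -1:] ^ l) \<ge> 0" for k l
  proof -
    have "pcompose [:0, 1:] u = u" "pcompose [:1, -1:] u = 1 - u"
      by (simp_all add: pcompose_pCons one_pCons[symmetric] pcompose_1)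
    moreover have "pcompose (p ^ i) u = pcompose p u ^ i" for p i
      by (induction i) (simp_all add: pcompose_mult pcompose_1)
    ultimately have "L' ([:0, 1:] ^ k * [:1, -1:] ^ l) = L (u ^ k * (1 - u) ^ l)"
      by (simp only: L'_def pcompose_mult)
    also have "\<dots> = (1/(2*C)) ^ k * (1/(2*C)) ^ l * L ([:C, 1:] ^ k * [:C, -1:] ^ l)"
      unfolding u(2) unfolding u(1) smult_power mult_smult_left mult_smult_right scale by (simp only: mult_ac)
    also have "\<dots> \<ge> 0"
      using pos \<open>C > 0\<close> by simp
    finally show ?thesis .
  qed
  have "L' (p + q) = L' p + L' q" "L' (smult c p) = c * L' p" "L' 1 = 1" for p q c
    by (simp_all add: L'_def pcompose_add pcompose_smult pcompose_1 add scale one)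
  with pos' obtain \<nu> where \<nu>: "real_distribution \<nu>" "AE t in \<nu>. t \<in> {0..1}" "\<And>p. (\<integral>t. poly p t \<partial>\<nu>) = L' p"
    using hausdorff_moment_problem[of L'] by metis
  interpret real_distribution \<nu> by (rule \<nu>)
  define g where "g t = 2 * C * t - C" for t
  have g [measurable]: "g \<in> borel_measurable borel" unfolding g_def by measurable
  show ?thesis
  proof
    show "real_distribution (distr \<nu> borel g)" by (rule real_distribution_distr) simp
    have "AE t in \<nu>. \<bar>g t\<bar> \<le> C"
      using \<nu>(2)
    proof eventually_elim
      case (elim t)
      then have "C * t \<le> C * 1" "C * t \<ge> 0" using \<open>C > 0\<close> by (auto intro: mult_left_mono)
      then show ?case by (simp add: g_def abs_le_iff)
    qed
    then show "AE t in distr \<nu> borel g. \<bar>t\<bar> \<le> C" by (subst AE_distr_iff) auto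
    fix p
    have "poly (pcompose p [:-C, 2*C:]) = (\<lambda>t. poly p (g t))"
      by (simp add: fun_eq_iff poly_pcompose g_def mult_ac)
    then have "(\<integral>t. poly p t \<partial>distr \<nu> borel g) = (\<integral>t. poly (pcompose p [:-C, 2*C:]) t \<partial>\<nu>)"
      by (subst integral_distr) (auto intro!: borel_measurable_continuous_onI continuous_intros)
    also have "\<dots> = L (pcompose p (pcompose [:-C, 2*C:] u))"
      by (simp add: \<nu>(3) L'_def pcompose_assoc)
    also have "pcompose [:-C, 2*C:] u = [:0, 1:]"
      using \<open>C > 0\<close> by (simp add: pcompose_pCons u_def)
    finally show "(\<integral>t. poly p t \<partial>distr \<nu> borel g) = L p" by (simp add: pcompose_idR)
  qed
qed

section \<open>Measures of bounded support and their determination by moments\<close>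

lemma bounded_support_if_moments_bounded:
  fixes \<nu> :: "real measure"
  assumes "real_distribution \<nu>" "C \<ge> 0"
    and int: "\<And>k::nat. integrable \<nu> (\<lambda>t. t ^ k)" and le: "\<And>k::nat. (\<integral>t. t ^ (2 * k) \<partial>\<nu>) \<le> C ^ (2 * k)"
  shows "AE t in \<nu>. \<bar>t\<bar> \<le> C"
proof -
  interpret real_distribution \<nu> by fact
  have "AE t in \<nu>. \<bar>t\<bar> < r" if r: "r > C" for r
  proof -
    \<comment> \<open>Markov's inequality for t^(2k): mass beyond r > C would make the even moments
      grow at least like a multiple of r^(2k).\<close>
    have "prob {t. \<bar>t\<bar> \<ge> r} \<le> ((C / r)\<^sup>2) ^ k" for k
    proof -
      have "prob {t \<in> space \<nu>. r ^ (2 * k) \<le> t ^ (2 * k)} \<le> (\<integral>t. t ^ (2 * k) \<partial>\<nu>) / r ^ (2 * k)"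
        using r \<open>C \<ge> 0\<close> by (intro integral_Markov_inequality_measure[where A = "{}"] int) (auto simp: power_mult)
      also have "\<dots> \<le> C ^ (2 * k) / r ^ (2 * k)"
        using r \<open>C \<ge> 0\<close> by (intro divide_right_mono le) auto
      also have "\<dots> = ((C / r)\<^sup>2) ^ k" by (simp add: power_mult power_divide)
      finally have "prob {t \<in> space \<nu>. r ^ (2 * k) \<le> t ^ (2 * k)} \<le> ((C / r)\<^sup>2) ^ k" .
      moreover have "prob {t. \<bar>t\<bar> \<ge> r} \<le> prob {t \<in> space \<nu>. r ^ (2 * k) \<le> t ^ (2 * k)}"
      proof (rule finite_measure_mono)
        show "{t. \<bar>t\<bar> \<ge> r} \<subseteq> {t \<in> space \<nu>. r ^ (2 * k) \<le> t ^ (2 * k)}"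
        proof safe
          fix t :: real assume "\<bar>t\<bar> \<ge> r"
          then have "r ^ (2 * k) \<le> \<bar>t\<bar> ^ (2 * k)" using r \<open>C \<ge> 0\<close> by (intro power_mono) auto
          then show "r ^ (2 * k) \<le> t ^ (2 * k)" by (simp add: power_even_abs)
        qed simp
      qed measurable
      ultimately show ?thesis by linarith
    qed
    moreover have "(\<lambda>k. ((C / r)\<^sup>2) ^ k) \<longlonglongrightarrow> 0"
      using r \<open>C \<ge> 0\<close> by (intro LIMSEQ_realpow_zero) (auto simp: power_less_one_iff abs_square_less_1)
    ultimately have "prob {t. \<bar>t\<bar> \<ge> r} \<le> 0"
      by (intro LIMSEQ_le_const[of "\<lambda>k. ((C / r)\<^sup>2) ^ k"]) auto
    then have "prob {t. \<bar>t\<bar> \<ge> r} = 0" by (simp add: measure_le_0_iff)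
    then have "AE t in \<nu>. t \<notin> {t. \<bar>t\<bar> \<ge> r}" by (intro AE_not_in) (simp add: null_sets_def emeasure_eq_measure)
    then show ?thesis by eventually_elim auto
  qed
  \<comment> \<open>Each r > C has its own null set; countably many values of r suffice to reach
    C.\<close>
  then have "AE t in \<nu>. \<forall>n. \<bar>t\<bar> < C + 1 / real (Suc n)" by (subst AE_all_countable) auto
  then show ?thesis
  proof eventually_elim
    case (elim t)
    have "(\<lambda>n. C + 1 / real (Suc n)) \<longlonglongrightarrow> C + 0"
      by (intro tendsto_intros LIMSEQ_Suc[OF lim_const_over_n])
    then show ?case using elim by (intro LIMSEQ_le_const[of "\<lambda>n. C + 1 / real (Suc n)"]) (auto intro: less_imp_le)
  qed
qed

lemma (in real_distribution) integrable_continuous_of_AE_bounded: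
  fixes h :: "real \<Rightarrow> real"
  assumes AE: "AE t in M. \<bar>t\<bar> \<le> C" and h: "continuous_on UNIV h"
  shows "integrable M h"
proof -
  have "compact (h ` {-C..C})"
    by (intro compact_continuous_image continuous_on_subset[OF h]) auto
  from compact_imp_bounded[OF this] obtain b where b: "\<forall>s \<in> h ` {-C..C}. norm s \<le> b"
    unfolding bounded_iff by metis
  show ?thesis
  proof (rule integrable_const_bound)
    show "AE t in M. norm (h t) \<le> b" using AE by eventually_elim (use b in \<open>auto simp: abs_le_iff\<close>)
    show "h \<in> borel_measurable M" using borel_measurable_continuous_onI[OF h] by simp
  qed
qed

lemma (in real_distribution) integral_diff_le_of_AE_bounded:
  fixes f g :: "real \<Rightarrow> real"
  assumes AE: "AE t in M. \<bar>t\<bar> \<le> C" and "continuous_on UNIV f" "continuous_on UNIV g"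
    and le: "\<And>t. \<bar>t\<bar> \<le> C \<Longrightarrow> \<bar>f t - g t\<bar> \<le> \<delta>"
  shows "\<bar>(\<integral>t. f t \<partial>M) - (\<integral>t. g t \<partial>M)\<bar> \<le> \<delta>"
proof -
  have f: "integrable M f" and g: "integrable M g"
    by (rule integrable_continuous_of_AE_bounded[OF AE], fact)+
  have "\<bar>(\<integral>t. f t \<partial>M) - (\<integral>t. g t \<partial>M)\<bar> = \<bar>\<integral>t. f t - g t \<partial>M\<bar>" using f g by simp
  also have "\<dots> \<le> (\<integral>t. \<bar>f t - g t\<bar> \<partial>M)" by (rule integral_abs_bound)
  also have "\<dots> \<le> (\<integral>t. \<delta> \<partial>M)"
  proof (rule integral_mono_AE)
    show "AE t in M. \<bar>f t - g t\<bar> \<le> \<delta>" using AE by eventually_elim (rule le)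
  qed (use f g in auto)
  also have "\<dots> = \<delta>" using prob_space by simp
  finally show ?thesis .
qed

lemma polynomial_approx_interval:
  fixes f :: "real \<Rightarrow> real"
  assumes "continuous_on UNIV f" "\<delta> > 0"
  obtains a :: "nat \<Rightarrow> real" and m where "\<And>t. \<bar>t\<bar> \<le> C \<Longrightarrow> \<bar>f t - (\<Sum>i\<le>m. a i * t ^ i)\<bar> \<le> \<delta>"
proof -
  obtain g where "real_polynomial_function g" and g: "\<And>t. t \<in> {-C..C} \<Longrightarrow> \<bar>f t - g t\<bar> < \<delta>"
    using Stone_Weierstrass_real_polynomial_function[of "{-C..C}" f \<delta>] assms continuous_on_subset
    by (metis compact_Icc subset_UNIV)
  then obtain a m where "g = (\<lambda>t. \<Sum>i\<le>m. a i * t ^ i)"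
    using real_polynomial_function_iff_sum by blast
  with g have "\<bar>f t - (\<Sum>i\<le>m. a i * t ^ i)\<bar> \<le> \<delta>" if "\<bar>t\<bar> \<le> C" for t
    using that by (intro less_imp_le) (auto simp: abs_le_iff)
  with that show ?thesis by blast
qed

text \<open>By Weierstrass on [-C, C] the moments fix the integrals of all continuous functions, in
  particular of cos and sin, and hence the characteristic function.\<close>

lemma eq_if_bounded_support_moments_eq:
  fixes M N :: "real measure"
  assumes M: "real_distribution M" "AE t in M. \<bar>t\<bar> \<le> C" and N: "real_distribution N" "AE t in N. \<bar>t\<bar> \<le> C"
    and eq: "\<And>k::nat. (\<integral>t. t ^ k \<partial>M) = (\<integral>t. t ^ k \<partial>N)"
  shows "M = N"
proof (rule Levy_uniqueness)
  interpret M: real_distribution M by fact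
  interpret N: real_distribution N by fact
  have int: "integrable M (\<lambda>t. t ^ k)" "integrable N (\<lambda>t. t ^ k)" for k
    by (intro M.integrable_continuous_of_AE_bounded[OF M(2)] N.integrable_continuous_of_AE_bounded[OF N(2)]
        continuous_intros)+
  have eq': "(\<integral>t. f t \<partial>M) = (\<integral>t. f t \<partial>N)" if f: "continuous_on UNIV f" for f :: "real \<Rightarrow> real"
  proof (rule ccontr)
    define d where "d = \<bar>(\<integral>t. f t \<partial>M) - (\<integral>t. f t \<partial>N)\<bar>"
    assume "(\<integral>t. f t \<partial>M) \<noteq> (\<integral>t. f t \<partial>N)"
    \<comment> \<open>Two approximation errors of d / 3 cannot add up to the gap d.\<close>
    then have "d / 3 > 0" by (simp add: d_def)
    then obtain a m where a: "\<And>t. \<bar>t\<bar> \<le> C \<Longrightarrow> \<bar>f t - (\<Sum>i\<le>m. a i * t ^ i)\<bar> \<le> d / 3"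
      using polynomial_approx_interval[OF f] by metis
    have "(\<integral>t. (\<Sum>i\<le>m. a i * t ^ i) \<partial>M) = (\<integral>t. (\<Sum>i\<le>m. a i * t ^ i) \<partial>N)"
      using int eq by simp
    moreover have "\<bar>(\<integral>t. f t \<partial>M) - (\<integral>t. (\<Sum>i\<le>m. a i * t ^ i) \<partial>M)\<bar> \<le> d / 3"
      by (intro M.integral_diff_le_of_AE_bounded[OF M(2)] f a continuous_intros)
    moreover have "\<bar>(\<integral>t. f t \<partial>N) - (\<integral>t. (\<Sum>i\<le>m. a i * t ^ i) \<partial>N)\<bar> \<le> d / 3"
      by (intro N.integral_diff_le_of_AE_bounded[OF N(2)] f a continuous_intros)
    ultimately have "d \<le> d / 3 + d / 3" unfolding d_def by linarith
    with \<open>d / 3 > 0\<close> show False by simp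
  qed
  show "char M = char N"
  proof
    fix s
    have "(\<integral>t. cos (s * t) \<partial>M) = (\<integral>t. cos (s * t) \<partial>N)" "(\<integral>t. sin (s * t) \<partial>M) = (\<integral>t. sin (s * t) \<partial>N)"
      by (intro eq' continuous_intros)+
    then show "char M s = char N s"
      by (simp add: complex_eq_iff char_def M.integrable_iexp N.integrable_iexp Re_exp Im_exp
          flip: integral_Re integral_Im)
  qed
qed fact+

text \<open>The measures competing in the definition of \<open>spec_meas\<close> are not assumed to have bounded support,
  so uniqueness first recovers the support from the growth of the moments.\<close>

lemma spec_meas_eqI:
  assumes \<nu>: "real_distribution \<nu>" "AE t in \<nu>. \<bar>t\<bar> \<le> C"
    and moments: "\<And>k::nat. (\<integral>t. t ^ k \<partial>\<nu>) = Re (kpow A K k x x)" and "C \<ge> 0"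
  shows "spec_meas A K x = \<nu>"
  unfolding spec_meas_def
proof (rule the_equality)
  interpret \<nu>: real_distribution \<nu> by fact
  have int: "integrable \<nu> (\<lambda>t. t ^ k)" for k
    by (intro \<nu>.integrable_continuous_of_AE_bounded[OF \<nu>(2)] continuous_intros)
  then show "sets \<nu> = sets borel \<and> prob_space \<nu> \<and>
      (\<forall>k::nat. integrable \<nu> (\<lambda>t. t ^ k) \<and> (\<integral>t. t ^ k \<partial>\<nu>) = Re (kpow A K k x x))"
    by (auto simp: moments \<nu>.prob_space_axioms)
  fix \<nu>' :: "real measure"
  assume *: "sets \<nu>' = sets borel \<and> prob_space \<nu>' \<and>
      (\<forall>k::nat. integrable \<nu>' (\<lambda>t. t ^ k) \<and> (\<integral>t. t ^ k \<partial>\<nu>') = Re (kpow A K k x x))"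
  then have rd: "real_distribution \<nu>'"
    by (auto simp: real_distribution_def real_distribution_axioms_def dest: sets_eq_imp_space_eq)
  moreover have "AE t in \<nu>'. \<bar>t\<bar> \<le> C"
  proof (rule bounded_support_if_moments_bounded[OF rd \<open>C \<ge> 0\<close>])
    fix k :: nat
    have "(\<integral>t. t ^ (2 * k) \<partial>\<nu>') = (\<integral>t. t ^ (2 * k) \<partial>\<nu>)" using * moments by simp
    also have "\<dots> \<le> (\<integral>t. C ^ (2 * k) \<partial>\<nu>)"
    proof (rule integral_mono_AE)
      show "AE t in \<nu>. t ^ (2 * k) \<le> C ^ (2 * k)"
        using \<nu>(2)
      proof eventually_elim
        case (elim t)
        then have "\<bar>t\<bar> ^ (2 * k) \<le> C ^ (2 * k)" by (intro power_mono) auto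
        then show ?case by (simp add: power_even_abs)
      qed
    qed (use int in auto)
    finally show "(\<integral>t. t ^ (2 * k) \<partial>\<nu>') \<le> C ^ (2 * k)" using \<nu>.prob_space by simp
  qed (use * in auto)
  ultimately show "\<nu>' = \<nu>"
    using \<nu> * moments by (intro eq_if_bounded_support_moments_eq[of \<nu>' C \<nu>]) auto
qed

section \<open>Spectral measures of banded kernels\<close>

text \<open>The linear extension of X^i |-> \<open>h i\<close>. When \<open>h i\<close> is an entry
  of the i-th power of a kernel K, this is the same entry of p(K).\<close>

definition coeff_sum :: "(nat \<Rightarrow> 'b::real_vector) \<Rightarrow> real poly \<Rightarrow> 'b" where
  "coeff_sum h p = (\<Sum>i\<le>degree p. coeff p i *\<^sub>R h i)"

lemma coeff_sum_eq: "degree p \<le> n \<Longrightarrow> coeff_sum h p = (\<Sum>i\<le>n. coeff p i *\<^sub>R h i)"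
  unfolding coeff_sum_def by (rule sum.mono_neutral_left) (auto simp: coeff_eq_0)

lemma coeff_sum_0 [simp]: "coeff_sum h 0 = 0"
  by (simp add: coeff_sum_def)

lemma coeff_sum_add: "coeff_sum h (p + q) = coeff_sum h p + coeff_sum h q"
proof -
  let ?n = "max (degree p) (degree q)"
  have "coeff_sum h (p + q) = (\<Sum>i\<le>?n. coeff (p + q) i *\<^sub>R h i)"
    by (intro coeff_sum_eq degree_add_le) auto
  then show ?thesis
    by (simp add: coeff_sum_eq[of p ?n] coeff_sum_eq[of q ?n] scaleR_left_distrib sum.distrib)
qed

lemma coeff_sum_smult: "coeff_sum h (smult c p) = c *\<^sub>R coeff_sum h p"
  by (subst coeff_sum_eq[of _ "degree p"]) (auto simp: coeff_sum_def scaleR_right.sum)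

lemma coeff_sum_pCons: "coeff_sum h (pCons a p) = a *\<^sub>R h 0 + coeff_sum (\<lambda>i. h (Suc i)) p"
  by (subst coeff_sum_eq[of _ "Suc (degree p)"]) (auto simp: degree_pCons_le coeff_sum_def sum.atMost_Suc_shift simp del: sum.atMost_Suc)

lemma coeff_sum_monom: "coeff_sum h (monom 1 k) = h k"
  by (subst coeff_sum_eq[of _ k]) (auto simp: degree_monom_eq if_distrib[of "\<lambda>c. c *\<^sub>R _"] cong: if_cong)

text \<open>One setting for the operators on the group and on the finite graphs. Row sums of |K| are
  at most \<open>B * D\<close>, which bounds the quadratic form. The point is uniformity: the
  constant hidden in \<open>selfadjoint_kernel\<close> may vary with the kernel, whereas
  \<open>B\<close> and \<open>D\<close> can be chosen once for all.\<close>

locale banded_kernel =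
  fixes A :: "'a set" and K :: "'a \<Rightarrow> 'a \<Rightarrow> complex" and N :: "'a \<Rightarrow> 'a set" and D :: nat and B :: real
  assumes herm: "y \<in> A \<Longrightarrow> z \<in> A \<Longrightarrow> K z y = cnj (K y z)"
    and N: "y \<in> A \<Longrightarrow> finite (N y)" "y \<in> A \<Longrightarrow> N y \<subseteq> A" "y \<in> A \<Longrightarrow> card (N y) \<le> D"
    and zero: "y \<in> A \<Longrightarrow> z \<in> A \<Longrightarrow> z \<notin> N y \<Longrightarrow> K y z = 0"
    and bound: "y \<in> A \<Longrightarrow> z \<in> A \<Longrightarrow> cmod (K y z) \<le> B"
begin

text \<open>All vectors p(K) delta_x are of this kind, which turns the infinite sums in
  \<open>app\<close> and \<open>ip\<close> into finite ones. Only values on \<open>A\<close>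
  count.\<close>

definition fsupp :: "('a \<Rightarrow> complex) \<Rightarrow> bool" where
  "fsupp v \<longleftrightarrow> finite {y \<in> A. v y \<noteq> 0}"

definition app :: "('a \<Rightarrow> complex) \<Rightarrow> 'a \<Rightarrow> complex" where
  "app v y = infsum (\<lambda>z. K y z * v z) A"

definition ip :: "('a \<Rightarrow> complex) \<Rightarrow> ('a \<Rightarrow> complex) \<Rightarrow> complex" where
  "ip u v = infsum (\<lambda>y. cnj (u y) * v y) A"

lemma infsum_A_eq_sum:
  fixes h :: "'a \<Rightarrow> complex"
  assumes "finite F" "F \<subseteq> A" "\<And>y. y \<in> A - F \<Longrightarrow> h y = 0"
  shows "infsum h A = sum h F"
proof -
  have "infsum h A = infsum h F" by (rule infsum_cong_neutral) (use assms in auto)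
  then show ?thesis using assms by simp
qed

lemma ip_eq_sum:
  assumes "finite F" "F \<subseteq> A" "\<And>y. y \<in> A - F \<Longrightarrow> u y = 0 \<or> v y = 0"
  shows "ip u v = (\<Sum>y\<in>F. cnj (u y) * v y)"
  unfolding ip_def using assms by (intro infsum_A_eq_sum) auto

lemma app_eq_sum:
  assumes "finite F" "F \<subseteq> A" "\<And>y. y \<in> A - F \<Longrightarrow> v y = 0"
  shows "app v y = (\<Sum>z\<in>F. K y z * v z)"
  unfolding app_def using assms by (intro infsum_A_eq_sum) auto

lemma fsuppE:
  assumes "fsupp v"
  obtains F where "finite F" "F \<subseteq> A" "\<And>y. y \<in> A - F \<Longrightarrow> v y = 0"
  using assms by (intro that[of "{y \<in> A. v y \<noteq> 0}"]) (auto simp: fsupp_def)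

lemma fsupp2E:
  assumes "fsupp u" "fsupp v"
  obtains F where "finite F" "F \<subseteq> A" "\<And>y. y \<in> A - F \<Longrightarrow> u y = 0" "\<And>y. y \<in> A - F \<Longrightarrow> v y = 0"
  using assms by (intro that[of "{y \<in> A. u y \<noteq> 0} \<union> {y \<in> A. v y \<noteq> 0}"]) (auto simp: fsupp_def)

lemma fsuppI: "finite F \<Longrightarrow> (\<And>y. y \<in> A - F \<Longrightarrow> v y = 0) \<Longrightarrow> fsupp v"
  unfolding fsupp_def by (rule finite_subset[of _ F]) auto

lemma fsupp_app:
  assumes "fsupp v" shows "fsupp (app v)"
proof -
  obtain F where F: "finite F" "F \<subseteq> A" "\<And>y. y \<in> A - F \<Longrightarrow> v y = 0"
    using fsuppE[OF assms] by metis
  show ?thesis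
  proof (rule fsuppI)
    show "finite (\<Union>z\<in>F. N z)" using F N by auto
    fix y assume y: "y \<in> A - (\<Union>z\<in>F. N z)"
    \<comment> \<open>\<open>zero\<close> confines the rows; Hermitian symmetry confines the columns
      to the same sets, and columns govern the support of \<open>app v\<close>.\<close>
    have "K y z = 0" if "z \<in> F" for z
      using zero[of z y] herm[of z y] y that F by auto
    moreover have "app v y = (\<Sum>z\<in>F. K y z * v z)" using F by (intro app_eq_sum) auto
    ultimately show "app v y = 0" by simp
  qed
qed

lemma ip_app_left:
  assumes "fsupp u" "fsupp v" shows "ip (app u) v = ip u (app v)"
proof -
  obtain F where F: "finite F" "F \<subseteq> A" "\<And>y. y \<in> A - F \<Longrightarrow> u y = 0" "\<And>y. y \<in> A - F \<Longrightarrow> v y = 0"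
    using fsupp2E[OF assms] by metis
  have au: "app u y = (\<Sum>z\<in>F. K y z * u z)" and av: "app v y = (\<Sum>z\<in>F. K y z * v z)" for y
    using F by (intro app_eq_sum; auto)+
  \<comment> \<open>\<open>app u\<close> and \<open>app v\<close> may be nonzero outside
    \<open>F\<close>, but each is paired with a vector that vanishes there.\<close>
  have ip: "ip (app u) v = (\<Sum>y\<in>F. cnj (app u y) * v y)" "ip u (app v) = (\<Sum>y\<in>F. cnj (u y) * app v y)"
    using F by (intro ip_eq_sum; auto)+
  have "ip (app u) v = (\<Sum>y\<in>F. \<Sum>z\<in>F. cnj (K y z) * cnj (u z) * v y)"
    by (simp add: ip au sum_distrib_right)
  also have "\<dots> = (\<Sum>y\<in>F. \<Sum>z\<in>F. cnj (u z) * (K z y * v y))"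
  proof (intro sum.cong refl)
    fix y z assume "y \<in> F" "z \<in> F"
    with F have "cnj (K y z) = K z y" by (subst herm[of y z]) auto
    then show "cnj (K y z) * cnj (u z) * v y = cnj (u z) * (K z y * v y)" by simp
  qed
  also have "\<dots> = (\<Sum>z\<in>F. \<Sum>y\<in>F. cnj (u z) * (K z y * v y))" by (rule sum.swap)
  also have "\<dots> = ip u (app v)"
    by (simp add: ip av sum_distrib_left)
  finally show ?thesis .
qed

lemma B_nonneg: "y \<in> A \<Longrightarrow> B \<ge> 0"
  using bound[of y y] norm_ge_zero order_trans by blast

text \<open>Schur's test. The product |v_y| |v_z| is at most half the sum of the squares; by
  symmetry of |K| both halves contribute equally, and each row sum of |K| is at most
  \<open>B * D\<close>.\<close>

lemma cmod_ip_app_le: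
  assumes "fsupp v" shows "cmod (ip v (app v)) \<le> B * D * Re (ip v v)"
proof -
  obtain F where F: "finite F" "F \<subseteq> A" "\<And>y. y \<in> A - F \<Longrightarrow> v y = 0"
    using fsuppE[OF assms] by metis
  have row: "(\<Sum>z\<in>F. cmod (K y z)) \<le> B * D" if "y \<in> F" for y
  proof -
    have y: "y \<in> A" using that F by auto
    have "(\<Sum>z\<in>F. cmod (K y z)) = (\<Sum>z\<in>F \<inter> N y. cmod (K y z))"
      using F y zero by (intro sum.mono_neutral_right) auto
    also have "\<dots> \<le> (\<Sum>z\<in>F \<inter> N y. B)" using F y bound by (intro sum_mono) auto
    also have "\<dots> = B * card (F \<inter> N y)" by simp
    also have "\<dots> \<le> B * D"
      using N[OF y] B_nonneg[OF y] by (intro mult_left_mono) (auto intro: order_trans[OF card_mono])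
    finally show ?thesis .
  qed
  have av: "app v y = (\<Sum>z\<in>F. K y z * v z)" for y
    using F by (intro app_eq_sum; auto)
  have ip: "ip v w = (\<Sum>y\<in>F. cnj (v y) * w y)" for w
    using F by (intro ip_eq_sum; auto)
  have nn: "Re (ip v v) = (\<Sum>y\<in>F. (cmod (v y))\<^sup>2)"
    unfolding ip by (simp only: complex_norm_square[symmetric] mult.commute[of "cnj _"]) simp
  have "ip v (app v) = (\<Sum>y\<in>F. \<Sum>z\<in>F. cnj (v y) * (K y z * v z))"
    by (simp add: ip av sum_distrib_left)
  then have "cmod (ip v (app v)) \<le> (\<Sum>y\<in>F. \<Sum>z\<in>F. cmod (cnj (v y) * (K y z * v z)))"
    by (auto intro!: order_trans[OF norm_sum] sum_mono)
  also have "\<dots> \<le> (\<Sum>y\<in>F. \<Sum>z\<in>F. cmod (K y z) * (cmod (v y))\<^sup>2 / 2 + cmod (K y z) * (cmod (v z))\<^sup>2 / 2)"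
  proof (intro sum_mono)
    fix y z
    have "2 * (cmod (v y) * cmod (v z)) \<le> (cmod (v y))\<^sup>2 + (cmod (v z))\<^sup>2"
      using sum_squares_bound[of "cmod (v y)" "cmod (v z)"] by simp
    then have "cmod (K y z) * (2 * (cmod (v y) * cmod (v z))) \<le> cmod (K y z) * ((cmod (v y))\<^sup>2 + (cmod (v z))\<^sup>2)"
      by (intro mult_left_mono) auto
    then show "cmod (cnj (v y) * (K y z * v z)) \<le> cmod (K y z) * (cmod (v y))\<^sup>2 / 2 + cmod (K y z) * (cmod (v z))\<^sup>2 / 2"
      by (simp add: norm_mult algebra_simps)
  qed
  also have "\<dots> = (\<Sum>y\<in>F. \<Sum>z\<in>F. cmod (K y z) * (cmod (v y))\<^sup>2 / 2) + (\<Sum>y\<in>F. \<Sum>z\<in>F. cmod (K y z) * (cmod (v z))\<^sup>2 / 2)"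
    by (simp add: sum.distrib)
  also have "(\<Sum>y\<in>F. \<Sum>z\<in>F. cmod (K y z) * (cmod (v z))\<^sup>2 / 2) = (\<Sum>z\<in>F. \<Sum>y\<in>F. cmod (K y z) * (cmod (v z))\<^sup>2 / 2)"
    by (rule sum.swap)
  also have "\<dots> = (\<Sum>y\<in>F. \<Sum>z\<in>F. cmod (K y z) * (cmod (v y))\<^sup>2 / 2)"
    using F herm by (intro sum.cong refl) (metis complex_mod_cnj subset_iff)
  also have "(\<Sum>y\<in>F. \<Sum>z\<in>F. cmod (K y z) * (cmod (v y))\<^sup>2 / 2) + (\<Sum>y\<in>F. \<Sum>z\<in>F. cmod (K y z) * (cmod (v y))\<^sup>2 / 2)
        = (\<Sum>y\<in>F. (\<Sum>z\<in>F. cmod (K y z)) * (cmod (v y))\<^sup>2)"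
    by (simp add: sum.distrib[symmetric] sum_distrib_right)
  also have "\<dots> \<le> (\<Sum>y\<in>F. B * D * (cmod (v y))\<^sup>2)" by (intro sum_mono mult_right_mono row) auto
  finally show ?thesis unfolding nn by (simp add: sum_distrib_left)
qed

text \<open>The vector p(K) delta_x, evaluated at y.\<close>

definition vec :: "'a \<Rightarrow> real poly \<Rightarrow> 'a \<Rightarrow> complex" where
  "vec x p y = coeff_sum (\<lambda>i. kpow A K i y x) p"

lemma kpow_Suc_eq_app: "kpow A K (Suc k) y x = app (\<lambda>z. kpow A K k z x) y"
  by (simp add: kmult_def app_def)

lemma fsupp_kpow: "fsupp (\<lambda>y. kpow A K k y x)"
proof (induction k)
  case 0
  show ?case by (rule fsuppI[of "{x}"]) auto
next
  case (Suc k)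
  then show ?case unfolding kpow_Suc_eq_app by (rule fsupp_app)
qed

lemma fsupp_vec: "fsupp (vec x p)"
proof (rule fsuppI)
  show "finite (\<Union>i\<le>degree p. {y \<in> A. kpow A K i y x \<noteq> 0})"
    using fsupp_kpow by (auto simp: fsupp_def)
qed (auto simp: vec_def coeff_sum_def intro!: sum.neutral)

text \<open>Linearity over a finite set containing the supports of all powers K^i delta_x that occur
  in p. Note that \<open>pCons 0 p\<close> is X p.\<close>

lemma app_vec: "app (vec x p) y = vec x (pCons 0 p) y"
proof -
  define F where "F = (\<Union>i\<le>degree p. {y \<in> A. kpow A K i y x \<noteq> 0})"
  have F: "finite F" "F \<subseteq> A" using fsupp_kpow by (auto simp: F_def fsupp_def)
  have k: "kpow A K i z x = 0" if "z \<in> A - F" "i \<le> degree p" for z i using that by (auto simp: F_def)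
  have v: "vec x p z = 0" if "z \<in> A - F" for z using k[OF that] by (auto simp: vec_def coeff_sum_def intro!: sum.neutral)
  have "app (vec x p) y = (\<Sum>z\<in>F. \<Sum>i\<le>degree p. coeff p i *\<^sub>R (K y z * kpow A K i z x))"
    using F v by (subst app_eq_sum[of F]) (auto simp: vec_def coeff_sum_def sum_distrib_left)
  also have "\<dots> = (\<Sum>i\<le>degree p. \<Sum>z\<in>F. coeff p i *\<^sub>R (K y z * kpow A K i z x))" by (rule sum.swap)
  also have "\<dots> = (\<Sum>i\<le>degree p. coeff p i *\<^sub>R app (\<lambda>z. kpow A K i z x) y)"
    using F k by (intro sum.cong refl, subst app_eq_sum[of F]) (auto simp: scaleR_right.sum)
  also have "\<dots> = vec x (pCons 0 p) y"
    unfolding vec_def coeff_sum_pCons by (simp add: coeff_sum_def kpow_Suc_eq_app[symmetric] del: kpow.simps)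
  finally show ?thesis .
qed

text \<open>Self-adjointness moves K across the inner product, one factor X of p at a time;
  coefficients are real, so no conjugates appear. With p = q it makes p |-> <delta_x, p(K) delta_x>
  nonnegative on squares.\<close>

lemma ip_vec_vec:
  assumes "x \<in> A"
  shows "ip (vec x p) (vec x q) = vec x (p * q) x"
proof (induction p arbitrary: q)
  case 0
  then show ?case by (simp add: vec_def ip_def)
next
  case (pCons a p)
  obtain F0 where F0: "finite F0" "F0 \<subseteq> A" "\<And>y. y \<in> A - F0 \<Longrightarrow> vec x q y = 0"
    using fsuppE[OF fsupp_vec] by metis
  define F where "F = insert x F0"
  have F: "finite F" "F \<subseteq> A" "\<And>y. y \<in> A - F \<Longrightarrow> vec x q y = 0"
    using F0 assms by (auto simp: F_def)
  have "vec x (pCons a p) y = a *\<^sub>R (if y = x then 1 else 0) + app (vec x p) y" for y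
    unfolding app_vec by (simp add: vec_def coeff_sum_pCons)
  then have "ip (vec x (pCons a p)) (vec x q)
     = (\<Sum>y\<in>F. a *\<^sub>R ((if y = x then 1 else 0) * vec x q y)) + (\<Sum>y\<in>F. cnj (app (vec x p) y) * vec x q y)"
    using F by (subst ip_eq_sum[of F]) (auto simp: sum.distrib[symmetric] distrib_right complex_cnj_scaleR intro!: sum.cong)
  also have "(\<Sum>y\<in>F. a *\<^sub>R ((if y = x then 1 else 0) * vec x q y)) = a *\<^sub>R vec x q x"
  proof -
    have "(\<Sum>y\<in>F. a *\<^sub>R ((if y = x then 1 else 0) * vec x q y)) = (\<Sum>y\<in>F. if y = x then a *\<^sub>R vec x q y else 0)"
      by (intro sum.cong) auto
    then show ?thesis using F by (simp add: F_def)
  qed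
  also have "(\<Sum>y\<in>F. cnj (app (vec x p) y) * vec x q y) = ip (app (vec x p)) (vec x q)"
    using F by (subst ip_eq_sum[of F]) auto
  also have "\<dots> = ip (vec x p) (vec x (pCons 0 q))"
    unfolding ip_app_left[OF fsupp_vec fsupp_vec] by (simp add: app_vec ip_def)
  also have "\<dots> = vec x (p * pCons 0 q) x" by (rule pCons.IH)
  finally show ?case by (simp add: vec_def coeff_sum_add coeff_sum_smult mult_pCons_left mult_pCons_right)
qed

lemma Re_ip_self_nonneg: "fsupp v \<Longrightarrow> Re (ip v v) \<ge> 0"
  by (erule fsuppE, subst ip_eq_sum) (auto intro!: sum_nonneg)

text \<open>The functional \<open>L\<close> is nonnegative on squares, and the quadratic form bound
  |L(X q^2)| <= C L(q^2) extends this to (C + X) q^2 and (C - X) q^2. Halving the exponents reduces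
  (C + X)^k (C - X)^l to a square times 1, C + X, C - X or (C + X)(C - X), according to the parities
  of k and l.\<close>

theorem spec_meas_banded:
  assumes x: "x \<in> A" and C: "C > 0" "B * D \<le> C"
  shows "real_distribution (spec_meas A K x)" "AE t in spec_meas A K x. \<bar>t\<bar> \<le> C"
    "\<And>k::nat. (\<integral>t. t ^ k \<partial>spec_meas A K x) = Re (kpow A K k x x)"
proof -
  define L where "L p = Re (vec x p x)" for p
  let ?u = "[:C, 1:]" and ?w = "[:C, -1:]"
  have L_add: "L (p + q) = L p + L q" and L_scale: "L (smult c p) = c * L p" for p q c
    by (simp_all add: L_def vec_def coeff_sum_add coeff_sum_smult)
  have L_monom: "L (monom 1 k) = Re (kpow A K k x x)" for k
    by (simp add: L_def vec_def coeff_sum_monom)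
  then have L_1: "L 1 = 1" using L_monom[of 0] by (simp add: monom_0 one_pCons)
  have sq: "L (q * q) \<ge> 0" for q
    using Re_ip_self_nonneg[OF fsupp_vec, of x q] by (simp add: L_def ip_vec_vec[OF x])
  have Lx: "\<bar>L (q * pCons 0 q)\<bar> \<le> C * L (q * q)" for q
  proof -
    have "ip (vec x q) (app (vec x q)) = ip (vec x q) (vec x (pCons 0 q))" by (simp add: ip_def app_vec)
    then have "\<bar>L (q * pCons 0 q)\<bar> \<le> cmod (ip (vec x q) (app (vec x q)))"
      using abs_Re_le_cmod by (simp add: L_def ip_vec_vec[OF x])
    also have "\<dots> \<le> B * D * Re (ip (vec x q) (vec x q))" by (rule cmod_ip_app_le[OF fsupp_vec])
    also have "\<dots> \<le> C * Re (ip (vec x q) (vec x q))"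
      by (intro mult_right_mono C Re_ip_self_nonneg fsupp_vec)
    finally show ?thesis by (simp add: L_def ip_vec_vec[OF x])
  qed
  have u: "?u * (q * q) = smult C (q * q) + q * pCons 0 q" and w: "?w * (q * q) = smult C (q * q) + smult (-1) (q * pCons 0 q)" for q
    by (simp_all add: mult_pCons_left mult_pCons_right)
  have Lu: "L (?u * (q * q)) \<ge> 0" and Lw: "L (?w * (q * q)) \<ge> 0" for q
    unfolding u w L_add L_scale using Lx[of q] by auto
  \<comment> \<open>\<open>u w (u + w) = u\<^sup>2 w + w\<^sup>2 u\<close> with \<open>u + w = 2 C\<close>\<close>
  have Luw: "L (?u * ?w * (q * q)) \<ge> 0" for q
  proof -
    have "smult (2 * C) (?u * ?w * (q * q)) = (?u + ?w) * (?u * ?w * (q * q))" by (simp add: mult_pCons_left)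
    also have "\<dots> = ?w * ((?u * q) * (?u * q)) + ?u * ((?w * q) * (?w * q))" by algebra
    finally have "2 * C * L (?u * ?w * (q * q)) = L (?w * ((?u * q) * (?u * q))) + L (?u * ((?w * q) * (?w * q)))"
      by (metis L_add L_scale)
    also have "\<dots> \<ge> 0" using Lu Lw by (intro add_nonneg_nonneg)
    finally show ?thesis using C by (simp add: zero_le_mult_iff)
  qed
  have pos: "L (?u ^ k * ?w ^ l) \<ge> 0" for k l
  proof -
    have k: "?u ^ k = ?u ^ (k mod 2) * (?u ^ (k div 2) * ?u ^ (k div 2))"
      and l: "?w ^ l = ?w ^ (l mod 2) * (?w ^ (l div 2) * ?w ^ (l div 2))"
      by (simp_all flip: power_add mult_2)
    define q where "q = ?u ^ (k div 2) * ?w ^ (l div 2)"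
    have "?u ^ k * ?w ^ l = ?u ^ (k mod 2) * ?w ^ (l mod 2) * (q * q)"
      unfolding k l q_def by (simp only: mult_ac)
    moreover have "k mod 2 = 0 \<or> k mod 2 = 1" "l mod 2 = 0 \<or> l mod 2 = 1" by auto
    ultimately show ?thesis using sq[of q] Lu[of q] Lw[of q] Luw[of q] by auto
  qed
  obtain \<nu> where \<nu>: "real_distribution \<nu>" "AE t in \<nu>. \<bar>t\<bar> \<le> C" "\<And>p. (\<integral>t. poly p t \<partial>\<nu>) = L p"
    using moment_problem_interval[OF L_add L_scale L_1 C(1) pos] by blast
  have m: "(\<integral>t. t ^ k \<partial>\<nu>) = Re (kpow A K k x x)" for k
    using \<nu>(3)[of "monom 1 k"] by (simp add: L_monom poly_monom)
  have "spec_meas A K x = \<nu>" using C by (intro spec_meas_eqI[OF \<nu>(1,2) m]) auto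
  with \<nu> m show "real_distribution (spec_meas A K x)" "AE t in spec_meas A K x. \<bar>t\<bar> \<le> C"
    "\<And>k::nat. (\<integral>t. t ^ k \<partial>spec_meas A K x) = Re (kpow A K k x x)" by auto
qed

text \<open>This trades the spectral measure for finitely many diagonal entries of powers, which can
  be compared between the group and the finite graphs.\<close>

lemma spec_meas_polynomial_approx:
  assumes x: "x \<in> A" and C: "C > 0" "B * D \<le> C" and f: "continuous_on UNIV f"
    and a: "\<And>t. \<bar>t\<bar> \<le> C \<Longrightarrow> \<bar>f t - (\<Sum>i\<le>m. a i * t ^ i)\<bar> \<le> \<delta>"
  shows "\<bar>(\<integral>t. f t \<partial>spec_meas A K x) - (\<Sum>i\<le>m. a i * Re (kpow A K i x x))\<bar> \<le> \<delta>"
proof -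
  interpret sm: real_distribution "spec_meas A K x" by (rule spec_meas_banded(1)[OF x C])
  note AE = spec_meas_banded(2)[OF x C]
  have int: "integrable (spec_meas A K x) (\<lambda>t. t ^ i)" for i
    by (intro sm.integrable_continuous_of_AE_bounded[OF AE] continuous_intros)
  have "(\<integral>t. (\<Sum>i\<le>m. a i * t ^ i) \<partial>spec_meas A K x) = (\<Sum>i\<le>m. a i * Re (kpow A K i x x))"
    using int by (simp add: spec_meas_banded(3)[OF x C])
  moreover have "\<bar>(\<integral>t. f t \<partial>spec_meas A K x) - (\<integral>t. (\<Sum>i\<le>m. a i * t ^ i) \<partial>spec_meas A K x)\<bar> \<le> \<delta>"
    by (intro sm.integral_diff_le_of_AE_bounded[OF AE] f a continuous_intros)
  ultimately show ?thesis by simp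
qed

text \<open>Read off from the support of the spectral measure. It later bounds the contribution of
  vertices whose surroundings do not resemble the group.\<close>

lemma abs_Re_kpow_diag_le:
  assumes x: "x \<in> A" and C: "C > 0" "B * D \<le> C"
  shows "\<bar>Re (kpow A K k x x)\<bar> \<le> C ^ k"
proof -
  interpret sm: real_distribution "spec_meas A K x" by (rule spec_meas_banded(1)[OF x C])
  note AE = spec_meas_banded(2)[OF x C]
  have "\<bar>(\<integral>t. t ^ k \<partial>spec_meas A K x) - (\<integral>t. 0 \<partial>spec_meas A K x)\<bar> \<le> C ^ k"
    by (intro sm.integral_diff_le_of_AE_bounded[OF AE] continuous_intros) (auto simp: power_abs intro!: power_mono)
  then show ?thesis by (simp add: spec_meas_banded(3)[OF x C])
qed

end

section \<open>The configuration space\<close>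

text \<open>The type of letters carries only a metric, so a countable base is drawn from
  compactness: finite covers by balls of radius 1/(n+1), for all n.\<close>

lemma compact_metric_countable_basis:
  assumes "compact (UNIV :: 'x::metric_space set)"
  obtains \<B> :: "'x::metric_space set set" where "countable \<B>" "\<And>b. b \<in> \<B> \<Longrightarrow> open b" "UNIV \<in> \<B>"
    "\<And>U x. open U \<Longrightarrow> x \<in> U \<Longrightarrow> \<exists>b\<in>\<B>. x \<in> b \<and> b \<subseteq> U"
proof -
  have "\<exists>k :: 'x set. finite k \<and> UNIV \<subseteq> (\<Union>x\<in>k. ball x (inverse (real (Suc n))))" for n
    using assms unfolding compact_eq_totally_bounded by (auto elim!: allE[of _ "inverse (real (Suc n))"])
  then obtain k :: "nat \<Rightarrow> 'x set" where k: "\<And>n. finite (k n)" "\<And>n. UNIV \<subseteq> (\<Union>x\<in>k n. ball x (inverse (real (Suc n))))"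
    by metis
  define \<B> where "\<B> = insert UNIV (\<Union>n. (\<lambda>x. ball x (inverse (real (Suc n)))) ` k n)"
  show ?thesis
  proof
    show "countable \<B>" unfolding \<B>_def using k by (auto intro: countable_finite)
    show "open b" if "b \<in> \<B>" for b using that by (auto simp: \<B>_def)
    show "UNIV \<in> \<B>" by (simp add: \<B>_def)
    fix U :: "'x set" and x assume "open U" "x \<in> U"
    then obtain e where e: "e > 0" "ball x e \<subseteq> U" using open_contains_ball by blast
    \<comment> \<open>Half of e, because x need not be the center of the covering ball that contains
      it.\<close>
    then obtain n where n: "inverse (real (Suc n)) < e / 2" using reals_Archimedean[of "e / 2"] by auto
    obtain c where c: "c \<in> k n" "dist c x < inverse (real (Suc n))" using k(2)[of n] by (auto simp: subset_iff)
    have "ball c (inverse (real (Suc n))) \<subseteq> ball x e"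
    proof
      fix y assume "y \<in> ball c (inverse (real (Suc n)))"
      then show "y \<in> ball x e"
        using c n dist_triangle[of x y c] by (simp add: dist_commute)
    qed
    then show "\<exists>b\<in>\<B>. x \<in> b \<and> b \<subseteq> U"
      using c e by (intro bexI[of _ "ball c (inverse (real (Suc n)))"]) (auto simp: \<B>_def)
  qed
qed

lemma topspace_XG: "topspace (XG G) = (\<Pi>\<^sub>E g\<in>carrier G. UNIV)"
  by (simp add: XG_def)

lemma space_PiM_borel: "space (PiM I (\<lambda>_. borel)) = (\<Pi>\<^sub>E i\<in>I. UNIV)"
  by (simp add: space_PiM)

text \<open>A sigma-algebra absorbs countable unions only. Since the group and a base of the letters
  are countable, there are countably many cylinders with finitely many sides from the base, and
  those inside \<open>W\<close> exhaust it.\<close>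

lemma openin_XG_in_sets_PiM:
  assumes comp: "compact (UNIV :: 'x::metric_space set)" and count: "countable (carrier G)"
    and W: "openin (XG G :: ('g \<Rightarrow> 'x::metric_space) topology) W"
  shows "W \<in> sets (PiM (carrier G) (\<lambda>_. borel))"
proof -
  obtain \<B> :: "'x set set" where \<B>: "countable \<B>" "\<And>b. b \<in> \<B> \<Longrightarrow> open b" "UNIV \<in> \<B>"
    "\<And>U x. open U \<Longrightarrow> x \<in> U \<Longrightarrow> \<exists>b\<in>\<B>. x \<in> b \<and> b \<subseteq> U"
    using compact_metric_countable_basis[OF comp] by metis
  define cyl where "cyl J u = prod_emb (carrier G) (\<lambda>_. borel :: 'x measure) J (Pi\<^sub>E J u)" for J u
  define \<C> where "\<C> = (\<Union>J\<in>{J. finite J \<and> J \<subseteq> carrier G}. cyl J ` (\<Pi>\<^sub>E j\<in>J. \<B>))"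
  have "countable \<C>"
    unfolding \<C>_def using count \<B>(1)
    by (intro countable_UN countable_Collect_finite_subset countable_image countable_PiE) auto
  have \<C>_sets: "c \<in> sets (PiM (carrier G) (\<lambda>_. borel))" if "c \<in> \<C>" for c
  proof -
    from that obtain J u where "finite J" "J \<subseteq> carrier G" "u \<in> (\<Pi>\<^sub>E j\<in>J. \<B>)" "c = cyl J u"
      by (auto simp: \<C>_def)
    moreover from this have "u j \<in> sets borel" if "j \<in> J" for j using \<B>(2) that by (auto simp: PiE_iff)
    ultimately show ?thesis unfolding cyl_def by (auto intro!: sets_PiM_I)
  qed
  have "W = \<Union>{c \<in> \<C>. c \<subseteq> W}"
  proof (intro equalityI subsetI)
    fix \<omega> assume \<omega>: "\<omega> \<in> W"
    then have \<omega>E: "\<omega> \<in> (\<Pi>\<^sub>E g\<in>carrier G. UNIV)" using openin_subset[OF W] by (auto simp: topspace_XG)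
    obtain U where U: "finite {i \<in> carrier G. U i \<noteq> UNIV}" "\<And>i. i \<in> carrier G \<Longrightarrow> open (U i)"
      "\<omega> \<in> Pi\<^sub>E (carrier G) U" "Pi\<^sub>E (carrier G) U \<subseteq> W"
      using W \<omega> unfolding XG_def openin_product_topology_alt by force
    define J where "J = {i \<in> carrier G. U i \<noteq> UNIV}"
    have "\<forall>j\<in>J. \<exists>b\<in>\<B>. \<omega> j \<in> b \<and> b \<subseteq> U j" using \<B>(4) U by (auto simp: J_def)
    then obtain b where b: "\<And>j. j \<in> J \<Longrightarrow> b j \<in> \<B> \<and> \<omega> j \<in> b j \<and> b j \<subseteq> U j" by metis
    have "cyl J (restrict b J) \<in> \<C>" using U(1) b by (auto simp: \<C>_def J_def intro!: bexI[of _ J])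
    moreover have "\<omega> \<in> cyl J (restrict b J)"
      using \<omega>E b by (auto simp: cyl_def prod_emb_def)
    moreover have "cyl J (restrict b J) \<subseteq> Pi\<^sub>E (carrier G) U"
    proof
      fix \<eta> assume \<eta>: "\<eta> \<in> cyl J (restrict b J)"
      then have "\<eta> i \<in> U i" if "i \<in> carrier G" for i
        using b that by (cases "i \<in> J") (force simp: cyl_def prod_emb_def J_def PiE_iff)+
      moreover have "\<eta> \<in> extensional (carrier G)" using \<eta> by (auto simp: cyl_def prod_emb_def PiE_iff)
      ultimately show "\<eta> \<in> Pi\<^sub>E (carrier G) U" by (auto simp: PiE_iff)
    qed
    ultimately show "\<omega> \<in> \<Union>{c \<in> \<C>. c \<subseteq> W}" using U(4) by blast
  qed auto
  also have "\<dots> \<in> sets (PiM (carrier G) (\<lambda>_. borel))"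
    using \<open>countable \<C>\<close> \<C>_sets by (intro sets.countable_Union) (auto intro: countable_subset)
  finally show ?thesis .
qed

lemma continuous_map_XG_measurable:
  fixes F :: "('g \<Rightarrow> 'x::metric_space) \<Rightarrow> 'c::topological_space"
  assumes "compact (UNIV :: 'x set)" and "countable (carrier G)" and F: "continuous_map (XG G) euclidean F"
  shows "F \<in> borel_measurable (PiM (carrier G) (\<lambda>_. borel))"
proof (rule borel_measurableI)
  fix S :: "'c set" assume "open S"
  then have "openin (XG G) {\<omega> \<in> topspace (XG G). F \<omega> \<in> S}"
    using F by (simp add: continuous_map_def)
  then have "{\<omega> \<in> topspace (XG G). F \<omega> \<in> S} \<in> sets (PiM (carrier G) (\<lambda>_. borel))"
    by (rule openin_XG_in_sets_PiM[OF assms(1,2)])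
  then show "F -` S \<inter> space (PiM (carrier G) (\<lambda>_. borel)) \<in> sets (PiM (carrier G) (\<lambda>_. borel))"
    by (simp add: topspace_XG space_PiM_borel vimage_def Collect_conj_eq Int_commute)
qed

lemma continuous_map_XG_bounded:
  fixes F :: "('g \<Rightarrow> 'x::metric_space) \<Rightarrow> 'c::real_normed_vector"
  assumes comp: "compact (UNIV :: 'x set)" and F: "continuous_map (XG G) euclidean F"
  obtains B where "\<And>\<omega>. \<omega> \<in> topspace (XG G) \<Longrightarrow> norm (F \<omega>) \<le> B"
proof -
  have "compact_space (XG G :: ('g \<Rightarrow> 'x) topology)"
    using comp unfolding XG_def compact_space_product_topology by (simp add: compact_space_def)
  then have "compactin euclidean (F ` topspace (XG G))"
    using F image_compactin compact_space_def by blast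
  then have "bounded (F ` topspace (XG G))" by (simp add: compact_imp_bounded)
  then show ?thesis using that unfolding bounded_iff by blast
qed

section \<open>Word balls and sofic approximations\<close>

locale fg_sym =
  fixes G :: "('g, 'b) monoid_scheme" and S :: "'g set"
  assumes fg_sym: "fg_sym_group G S"
begin

sublocale group G using fg_sym by (simp add: fg_sym_group_def)

lemma S_finite: "finite S" and S_carrier: "S \<subseteq> carrier G" and S_inv: "s \<in> S \<Longrightarrow> inv\<^bsub>G\<^esub> s \<in> S"
  and S_generate: "generate G S = carrier G"
  using fg_sym by (auto simp: fg_sym_group_def)

definition wprod :: "'g list \<Rightarrow> 'g" where
  "wprod xs = foldr (\<lambda>s a. s \<otimes>\<^bsub>G\<^esub> a) xs \<one>\<^bsub>G\<^esub>"

definition wball :: "nat \<Rightarrow> 'g set" where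
  "wball k = {g \<in> carrier G. word_len G S g \<le> k}"

lemma wprod_simps [simp]: "wprod [] = \<one>\<^bsub>G\<^esub>" "wprod (s # xs) = s \<otimes>\<^bsub>G\<^esub> wprod xs"
  by (simp_all add: wprod_def)

lemma wprod_closed: "set xs \<subseteq> S \<Longrightarrow> wprod xs \<in> carrier G"
  using S_carrier by (induction xs) auto

lemma wprod_append: "set xs \<subseteq> S \<Longrightarrow> set ys \<subseteq> S \<Longrightarrow> wprod (xs @ ys) = wprod xs \<otimes>\<^bsub>G\<^esub> wprod ys"
  using S_carrier by (induction xs) (auto simp: m_assoc wprod_closed)

lemma inv_wprod: "set xs \<subseteq> S \<Longrightarrow> inv\<^bsub>G\<^esub> (wprod xs) = wprod (rev (map (\<lambda>s. inv\<^bsub>G\<^esub> s) xs))"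
proof (induction xs)
  case (Cons s xs)
  moreover from this have "set (rev (map (\<lambda>s. inv\<^bsub>G\<^esub> s) xs)) \<subseteq> S" using S_inv by auto
  ultimately show ?case
    using S_carrier S_inv by (auto simp: wprod_append inv_mult_group wprod_closed subset_iff)
qed simp

text \<open>Inverses in the generated subgroup are absorbed by the symmetry of \<open>S\<close>, so
  positive words suffice.\<close>

lemma ex_word:
  assumes "g \<in> carrier G" shows "\<exists>xs. set xs \<subseteq> S \<and> wprod xs = g"
proof -
  have "g \<in> generate G S" using assms S_generate by simp
  then show ?thesis
  proof (induction rule: generate.induct)
    case one
    show ?case by (intro exI[of _ "[]"]) simp
  next
    case (incl s)
    then show ?case using S_carrier by (intro exI[of _ "[s]"]) auto
  next
    case (inv s)
    then show ?case using S_carrier S_inv by (intro exI[of _ "[inv\<^bsub>G\<^esub> s]"]) auto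
  next
    case (eng g h)
    then obtain xs ys where "set xs \<subseteq> S" "wprod xs = g" "set ys \<subseteq> S" "wprod ys = h" by auto
    then show ?case by (intro exI[of _ "xs @ ys"]) (auto simp: wprod_append)
  qed
qed

lemma word_len_le_iff:
  assumes "g \<in> carrier G"
  shows "word_len G S g \<le> k \<longleftrightarrow> (\<exists>xs. length xs \<le> k \<and> set xs \<subseteq> S \<and> wprod xs = g)"
proof
  let ?P = "\<lambda>n. \<exists>xs. length xs = n \<and> set xs \<subseteq> S \<and> wprod xs = g"
  have wl: "word_len G S g = (LEAST n. ?P n)" by (simp add: word_len_def wprod_def)
  \<comment> \<open>Without such an n the \<open>LEAST\<close> in \<open>word_len\<close> would be
    unspecified.\<close>
  have "\<exists>n. ?P n" using ex_word[OF assms] by auto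
  then have "?P (word_len G S g)" unfolding wl by (rule LeastI_ex)
  then show "word_len G S g \<le> k \<Longrightarrow> \<exists>xs. length xs \<le> k \<and> set xs \<subseteq> S \<and> wprod xs = g" by metis
  show "\<exists>xs. length xs \<le> k \<and> set xs \<subseteq> S \<and> wprod xs = g \<Longrightarrow> word_len G S g \<le> k"
    unfolding wl by (metis (mono_tags, lifting) Least_le order_trans)
qed

lemma wballE:
  assumes "g \<in> wball k"
  obtains xs where "length xs \<le> k" "set xs \<subseteq> S" "wprod xs = g"
  using assms word_len_le_iff by (auto simp: wball_def)

lemma wballI: "length xs \<le> k \<Longrightarrow> set xs \<subseteq> S \<Longrightarrow> wprod xs \<in> wball k"
  using word_len_le_iff wprod_closed by (auto simp: wball_def)

lemma wball_carrier: "g \<in> wball k \<Longrightarrow> g \<in> carrier G"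
  by (simp add: wball_def)

lemma wball_mono: "g \<in> wball k \<Longrightarrow> k \<le> l \<Longrightarrow> g \<in> wball l"
  by (simp add: wball_def)

lemma one_in_wball: "\<one>\<^bsub>G\<^esub> \<in> wball k"
  using wballI[of "[]" k] by simp

lemma S_in_wball: "s \<in> S \<Longrightarrow> s \<in> wball (Suc k)"
  using wballI[of "[s]" "Suc k"] S_carrier by auto

lemma wball_mult: "g \<in> wball k \<Longrightarrow> h \<in> wball l \<Longrightarrow> g \<otimes>\<^bsub>G\<^esub> h \<in> wball (k + l)"
proof (elim wballE)
  fix xs ys assume *: "length xs \<le> k" "set xs \<subseteq> S" "wprod xs = g" "length ys \<le> l" "set ys \<subseteq> S" "wprod ys = h"
  then show "g \<otimes>\<^bsub>G\<^esub> h \<in> wball (k + l)" using wballI[of "xs @ ys" "k + l"] by (simp add: wprod_append)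
qed

lemma wball_inv: "g \<in> wball k \<Longrightarrow> inv\<^bsub>G\<^esub> g \<in> wball k"
proof (elim wballE)
  fix xs assume *: "length xs \<le> k" "set xs \<subseteq> S" "wprod xs = g"
  then have "set (rev (map (\<lambda>s. inv\<^bsub>G\<^esub> s) xs)) \<subseteq> S" using S_inv by auto
  then have "wprod (rev (map (\<lambda>s. inv\<^bsub>G\<^esub> s) xs)) \<in> wball k" using * by (intro wballI) auto
  then show "inv\<^bsub>G\<^esub> g \<in> wball k" using * by (simp add: inv_wprod[symmetric])
qed

lemma finite_wball: "finite (wball k)"
proof (rule finite_subset)
  show "wball k \<subseteq> wprod ` {xs. set xs \<subseteq> S \<and> length xs \<le> k}" by (auto elim!: wballE)
qed (use finite_lists_length_le[OF S_finite] in auto)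

lemma countable_carrier: "countable (carrier G)"
proof -
  have "carrier G = (\<Union>k. wball k)" by (auto simp: wball_def)
  moreover have "countable (\<Union>k. wball k)" using finite_wball by (intro countable_UN) (auto intro: countable_finite)
  ultimately show ?thesis by simp
qed

lemma ballS_one: "ballS G S \<one>\<^bsub>G\<^esub> k = wball k"
proof -
  have "inv\<^bsub>G\<^esub> h \<in> wball k \<longleftrightarrow> h \<in> wball k" if "h \<in> carrier G" for h
    using wball_inv[of h k] wball_inv[of "inv\<^bsub>G\<^esub> h" k] that by auto
  then show ?thesis by (auto simp: ballS_def dS_def wball_def)
qed

text \<open>Word balls are closed under inverses, so x and y may trade places. In this form the ball
  around x consists of the products a x with a in \<open>wball k\<close>.\<close>

lemma dS_le_iff:
  assumes "x \<in> carrier G" "y \<in> carrier G"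
  shows "dS G S x y \<le> k \<longleftrightarrow> y \<otimes>\<^bsub>G\<^esub> inv\<^bsub>G\<^esub> x \<in> wball k"
proof -
  have "y \<otimes>\<^bsub>G\<^esub> inv\<^bsub>G\<^esub> x = inv\<^bsub>G\<^esub> (x \<otimes>\<^bsub>G\<^esub> inv\<^bsub>G\<^esub> y)" "x \<otimes>\<^bsub>G\<^esub> inv\<^bsub>G\<^esub> y = inv\<^bsub>G\<^esub> (y \<otimes>\<^bsub>G\<^esub> inv\<^bsub>G\<^esub> x)"
    using assms by (simp_all add: inv_mult_group)
  then have "y \<otimes>\<^bsub>G\<^esub> inv\<^bsub>G\<^esub> x \<in> wball k \<longleftrightarrow> x \<otimes>\<^bsub>G\<^esub> inv\<^bsub>G\<^esub> y \<in> wball k"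
    using wball_inv[of "x \<otimes>\<^bsub>G\<^esub> inv\<^bsub>G\<^esub> y" k] wball_inv[of "y \<otimes>\<^bsub>G\<^esub> inv\<^bsub>G\<^esub> x" k] by argo
  then show ?thesis using assms by (simp add: dS_def wball_def)
qed

end

section \<open>Balls in the labeled graphs\<close>

lemma ballE_self: "v \<in> V n \<Longrightarrow> v \<in> ballE S V \<sigma> n v R"
  unfolding ballE_def by (auto intro!: exI[of _ 0] exI[of _ "\<lambda>_. v"])

lemma ballE_step:
  assumes "y \<in> ballE S V \<sigma> n v R" "adjE S \<sigma> n y z" "z \<in> V n"
  shows "z \<in> ballE S V \<sigma> n v (Suc R)"
proof -
  obtain k p where p: "k \<le> R" "p 0 = v" "p k = y" "\<forall>i\<le>k. p i \<in> V n" "\<forall>i<k. adjE S \<sigma> n (p i) (p (Suc i))"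
    using assms(1) unfolding ballE_def by blast
  define q where "q i = (if i \<le> k then p i else z)" for i
  have "adjE S \<sigma> n (q i) (q (Suc i))" if "i < Suc k" for i
    using that p assms by (cases "i = k") (auto simp: q_def)
  then have "q 0 = v \<and> q (Suc k) = z \<and> (\<forall>i\<le>Suc k. q i \<in> V n) \<and> (\<forall>i<Suc k. adjE S \<sigma> n (q i) (q (Suc i)))"
    using p assms by (auto simp: q_def)
  then show ?thesis
    using p(1) assms(3) unfolding ballE_def mem_Collect_eq by (intro conjI exI[of _ "Suc k"] exI[of _ q]) auto
qed

lemma ballE_mono: "y \<in> ballE S V \<sigma> n v R \<Longrightarrow> R \<le> R' \<Longrightarrow> y \<in> ballE S V \<sigma> n v R'"
  unfolding ballE_def mem_Collect_eq by (elim conjE exE) (intro conjI exI; (assumption | simp))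

text \<open>The predicate carries the number of steps, so that a radius can grow along the
  path.\<close>

lemma ballE_induct:
  assumes "y \<in> ballE S V \<sigma> n v R" and "v \<in> V n \<Longrightarrow> P 0 v"
    and "\<And>k y z. k < R \<Longrightarrow> P k y \<Longrightarrow> y \<in> V n \<Longrightarrow> z \<in> V n \<Longrightarrow> adjE S \<sigma> n y z \<Longrightarrow> P (Suc k) z"
  shows "\<exists>k\<le>R. P k y"
proof -
  obtain k p where p: "k \<le> R" "p 0 = v" "p k = y" "\<forall>i\<le>k. p i \<in> V n" "\<forall>i<k. adjE S \<sigma> n (p i) (p (Suc i))"
    using assms(1) unfolding ballE_def by blast
  have "P i (p i)" if "i \<le> k" for i
    using that
  proof (induction i)
    case 0
    then show ?case using p assms(2) by auto
  next
    case (Suc i)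
    then show ?case using p assms(3)[of i "p i" "p (Suc i)"] by auto
  qed
  with p show ?thesis by blast
qed

text \<open>Each label gives a vertex one outgoing and, by injectivity, at most one incoming edge.
  The two are counted separately, as sigma of an inverse generator need not be the inverse
  permutation. The bound does not depend on n or v.\<close>

lemma card_ballE_le:
  assumes "finite S" "finite (V n)" "\<And>s. s \<in> S \<Longrightarrow> inj (\<sigma> n s)"
  shows "card (ballE S V \<sigma> n v R) \<le> (1 + 2 * card S) ^ R"
proof -
  \<comment> \<open>The vertex itself is included so that the sets \<open>T k\<close> increase with
    k and also cover shorter paths.\<close>
  define nb where "nb y = insert y ((\<lambda>s. \<sigma> n s y) ` S \<union> (\<lambda>s. the_inv (\<sigma> n s) y) ` S)" for y
  have fin: "finite (nb y)" for y using assms(1) by (simp add: nb_def)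
  have nb: "card (nb y) \<le> 1 + 2 * card S" for y
  proof -
    have "card (nb y) \<le> Suc (card ((\<lambda>s. \<sigma> n s y) ` S \<union> (\<lambda>s. the_inv (\<sigma> n s) y) ` S))"
      unfolding nb_def by (rule card_insert_le_m1) (use assms(1) in \<open>auto simp: card_insert_if\<close>)
    also have "\<dots> \<le> Suc (card ((\<lambda>s. \<sigma> n s y) ` S) + card ((\<lambda>s. the_inv (\<sigma> n s) y) ` S))"
      using card_Un_le by simp
    also have "\<dots> \<le> Suc (card S + card S)"
      using card_image_le[OF assms(1), of "\<lambda>s. \<sigma> n s y"] card_image_le[OF assms(1), of "\<lambda>s. the_inv (\<sigma> n s) y"]
      by linarith
    finally show ?thesis by simp
  qed
  define T where "T k = ((\<lambda>X. \<Union>y\<in>X. nb y) ^^ k) {v}" for k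
  have T: "finite (T k) \<and> card (T k) \<le> (1 + 2 * card S) ^ k" for k
  proof (induction k)
    case (Suc k)
    have T': "T (Suc k) = (\<Union>y\<in>T k. nb y)" by (simp add: T_def)
    have "card (\<Union>y\<in>T k. nb y) \<le> (\<Sum>y\<in>T k. card (nb y))" using Suc by (intro card_UN_le) auto
    also have "\<dots> \<le> (\<Sum>y\<in>T k. 1 + 2 * card S)" by (intro sum_mono nb)
    also have "\<dots> = card (T k) * (1 + 2 * card S)" by simp
    also have "\<dots> \<le> (1 + 2 * card S) ^ k * (1 + 2 * card S)" using Suc by (intro mult_right_mono) auto
    finally show ?case using Suc fin by (auto simp: T' mult_ac)
  qed (simp add: T_def)
  have Tmono: "T k \<subseteq> T (Suc k)" for k by (auto simp: T_def nb_def)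
  have "ballE S V \<sigma> n v R \<subseteq> T R"
  proof
    fix y assume "y \<in> ballE S V \<sigma> n v R"
    then have "\<exists>k\<le>R. y \<in> T k"
    proof (rule ballE_induct[where P = "\<lambda>k y. y \<in> T k"])
      fix k y z assume "y \<in> T k" "adjE S \<sigma> n y z"
      then obtain s where s: "s \<in> S" "z = \<sigma> n s y \<or> y = \<sigma> n s z" by (auto simp: adjE_def)
      have "z \<in> nb y"
        using s(2)
      proof
        assume "y = \<sigma> n s z"
        then have "z = the_inv (\<sigma> n s) y" using the_inv_f_f[OF assms(3)[OF s(1)], of z] by simp
        then show ?thesis using s(1) by (auto simp: nb_def)
      qed (use s(1) in \<open>auto simp: nb_def\<close>)
      then show "z \<in> T (Suc k)" using \<open>y \<in> T k\<close> by (auto simp: T_def)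
    qed (simp add: T_def)
    then show "y \<in> T R" using lift_Suc_mono_le[of T, OF Tmono] by blast
  qed
  then show ?thesis using T[of R] by (meson card_mono order_trans)
qed

section \<open>Vertices near which the models act like the group\<close>

context fg_sym
begin

text \<open>A local form of \<open>good\<close> that, up to a loss in the radius, is inherited by the translates
  \<open>\<sigma>_g v\<close>; its failure is a finite union of asymptotically negligible events.\<close>

definition nice :: "(nat \<Rightarrow> 'v set) \<Rightarrow> (nat \<Rightarrow> 'g \<Rightarrow> 'v \<Rightarrow> 'v) \<Rightarrow> nat \<Rightarrow> nat \<Rightarrow> 'v \<Rightarrow> bool" where
  "nice V \<sigma> n k v \<longleftrightarrow> v \<in> V n \<and>
     (\<forall>g\<in>wball k. \<forall>h\<in>wball k. \<sigma> n g (\<sigma> n h v) = \<sigma> n (g \<otimes>\<^bsub>G\<^esub> h) v) \<and>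
     (\<forall>g\<in>wball k. g \<noteq> \<one>\<^bsub>G\<^esub> \<longrightarrow> \<sigma> n g v \<noteq> v)"

lemma niceD:
  assumes "nice V \<sigma> n k v"
  shows "v \<in> V n" "g \<in> wball k \<Longrightarrow> h \<in> wball k \<Longrightarrow> \<sigma> n g (\<sigma> n h v) = \<sigma> n (g \<otimes>\<^bsub>G\<^esub> h) v"
    "g \<in> wball k \<Longrightarrow> \<sigma> n g v = v \<Longrightarrow> g = \<one>\<^bsub>G\<^esub>"
  using assms by (auto simp: nice_def)

lemma nice_mono: "nice V \<sigma> n k v \<Longrightarrow> l \<le> k \<Longrightarrow> nice V \<sigma> n l v"
  unfolding nice_def by (auto intro: wball_mono)

context
  fixes V :: "nat \<Rightarrow> 'v set" and \<sigma> :: "nat \<Rightarrow> 'g \<Rightarrow> 'v \<Rightarrow> 'v" and n :: nat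
  assumes perm: "\<forall>g\<in>carrier G. \<sigma> n g permutes V n"
begin

lemma sigma_inj: "g \<in> carrier G \<Longrightarrow> \<sigma> n g u = \<sigma> n g w \<longleftrightarrow> u = w"
  using perm permutes_inj by (metis injD)

lemma sigma_in: "g \<in> carrier G \<Longrightarrow> v \<in> V n \<Longrightarrow> \<sigma> n g v \<in> V n"
  using perm permutes_in_image by metis

text \<open>A sofic approximation may send the identity to a nontrivial permutation. At a nice
  vertex multiplicativity makes that permutation idempotent on v, and injectivity cancels one
  application.\<close>

lemma nice_one:
  assumes "nice V \<sigma> n k v" shows "\<sigma> n \<one>\<^bsub>G\<^esub> v = v"
  using niceD(2)[OF assms one_in_wball one_in_wball] sigma_inj[of "\<one>\<^bsub>G\<^esub>"] by simp

text \<open>The radius doubles because g and h are compared through g^-1 h, which turns out to fix v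
  and lies in \<open>wball (2 * k)\<close>.\<close>

lemma nice_inj:
  assumes v: "nice V \<sigma> n (2 * k) v" and g: "g \<in> wball k" and h: "h \<in> wball k"
  shows "\<sigma> n g v = \<sigma> n h v \<longleftrightarrow> g = h"
proof
  assume eq: "\<sigma> n g v = \<sigma> n h v"
  have gc: "g \<in> carrier G" "h \<in> carrier G" using g h by (auto simp: wball_carrier)
  have ig: "inv\<^bsub>G\<^esub> g \<in> wball k" using wball_inv[OF g] .
  have "\<sigma> n (inv\<^bsub>G\<^esub> g \<otimes>\<^bsub>G\<^esub> h) v = \<sigma> n (inv\<^bsub>G\<^esub> g) (\<sigma> n g v)"
    unfolding eq using niceD(2)[OF v wball_mono[OF ig] wball_mono[OF h]] by simp
  also have "\<dots> = \<sigma> n (inv\<^bsub>G\<^esub> g \<otimes>\<^bsub>G\<^esub> g) v"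
    using niceD(2)[OF v wball_mono[OF ig] wball_mono[OF g]] by simp
  also have "\<dots> = v" using nice_one[OF v] gc by simp
  finally have "inv\<^bsub>G\<^esub> g \<otimes>\<^bsub>G\<^esub> h = \<one>\<^bsub>G\<^esub>"
    using niceD(3)[OF v] wball_mult[OF ig h] by (simp add: mult_2)
  then show "g = h" using gc by (metis inv_equality inv_inv inv_closed)
qed simp

text \<open>The radius is dictated by freeness: a g and g both lie in \<open>wball (k + l)\<close>
  and are separated at v by \<open>nice_inj\<close>. It also covers the products (a b) g and a (b g)
  that multiplicativity requires.\<close>

lemma nice_translate:
  assumes v: "nice V \<sigma> n (2 * (k + l)) v" and g: "g \<in> wball l"
  shows "nice V \<sigma> n k (\<sigma> n g v)"
  unfolding nice_def
proof (intro conjI ballI impI)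
  have gc: "g \<in> carrier G" using g wball_carrier by auto
  then show "\<sigma> n g v \<in> V n" using niceD(1)[OF v] by (rule sigma_in)
  have step: "\<sigma> n a (\<sigma> n b v) = \<sigma> n (a \<otimes>\<^bsub>G\<^esub> b) v" if "a \<in> wball (2 * k)" "b \<in> wball (k + l)" for a b
    using that by (intro niceD(2)[OF v]) (auto intro: wball_mono)
  fix a assume a: "a \<in> wball k"
  have ag: "a \<otimes>\<^bsub>G\<^esub> g \<in> wball (k + l)" by (rule wball_mult[OF a g])
  have ag': "\<sigma> n a (\<sigma> n g v) = \<sigma> n (a \<otimes>\<^bsub>G\<^esub> g) v"
    using a g by (intro step) (auto intro: wball_mono)
  {
    fix b assume b: "b \<in> wball k"
    have abc: "a \<in> carrier G" "b \<in> carrier G" using a b wball_carrier by auto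
    have "\<sigma> n b (\<sigma> n g v) = \<sigma> n (b \<otimes>\<^bsub>G\<^esub> g) v"
      using b g by (intro step) (auto intro: wball_mono)
    then have "\<sigma> n a (\<sigma> n b (\<sigma> n g v)) = \<sigma> n (a \<otimes>\<^bsub>G\<^esub> (b \<otimes>\<^bsub>G\<^esub> g)) v"
      using step[of a "b \<otimes>\<^bsub>G\<^esub> g"] wball_mult[OF b g] wball_mono[OF a, of "2 * k"] by simp
    also have "\<dots> = \<sigma> n (a \<otimes>\<^bsub>G\<^esub> b) (\<sigma> n g v)"
      using step[of "a \<otimes>\<^bsub>G\<^esub> b" g] wball_mult[OF a b] wball_mono[OF g, of "k + l"] abc gc
      by (simp add: mult_2 m_assoc)
    finally show "\<sigma> n a (\<sigma> n b (\<sigma> n g v)) = \<sigma> n (a \<otimes>\<^bsub>G\<^esub> b) (\<sigma> n g v)" .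
  }
  assume "a \<noteq> \<one>\<^bsub>G\<^esub>"
  then have "a \<otimes>\<^bsub>G\<^esub> g \<noteq> g" using wball_carrier[OF a] gc by simp
  then show "\<sigma> n a (\<sigma> n g v) \<noteq> \<sigma> n g v"
    unfolding ag' using nice_inj[OF v ag wball_mono[OF g]] by simp
qed

lemma ballE_nice:
  assumes v: "nice V \<sigma> n (Suc k) v"
  shows "ballE S V \<sigma> n v k = (\<lambda>g. \<sigma> n g v) ` wball k"
proof (intro equalityI subsetI)
  fix y assume "y \<in> ballE S V \<sigma> n v k"
  then have "\<exists>i\<le>k. y \<in> (\<lambda>g. \<sigma> n g v) ` wball i"
  proof (rule ballE_induct[where P = "\<lambda>i y. y \<in> (\<lambda>g. \<sigma> n g v) ` wball i"])
    show "v \<in> (\<lambda>g. \<sigma> n g v) ` wball 0"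
      using nice_one[OF v] one_in_wball by (intro image_eqI[of _ _ "\<one>\<^bsub>G\<^esub>"]) auto
    fix i y z
    assume "i < k" "y \<in> (\<lambda>g. \<sigma> n g v) ` wball i" "adjE S \<sigma> n y z"
    then obtain g s where g: "g \<in> wball i" "y = \<sigma> n g v" and s: "s \<in> S" "z = \<sigma> n s y \<or> y = \<sigma> n s z"
      by (auto simp: adjE_def)
    have gc: "g \<in> carrier G" and sc: "s \<in> carrier G" using g s wball_carrier S_carrier by auto
    show "z \<in> (\<lambda>g. \<sigma> n g v) ` wball (Suc i)"
      using s(2)
    proof
      assume "z = \<sigma> n s y"
      then have "z = \<sigma> n (s \<otimes>\<^bsub>G\<^esub> g) v"
        using g \<open>i < k\<close> niceD(2)[OF v S_in_wball[OF s(1)] wball_mono[OF g(1)]] by simp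
      then show ?thesis using wball_mult[OF S_in_wball[OF s(1), of 0] g(1)] by auto
    next
      assume y: "y = \<sigma> n s z"
      \<comment> \<open>Sigma of s^-1 need not undo sigma of s, so an edge arriving from z is
        inverted by injectivity: sigma of s sends both z and the translate of v by \<open>?h\<close>
        to y.\<close>
      let ?h = "inv\<^bsub>G\<^esub> s \<otimes>\<^bsub>G\<^esub> g"
      have h: "?h \<in> wball (Suc i)" using wball_mult[OF S_in_wball[OF S_inv[OF s(1)], of 0] g(1)] by simp
      have "\<sigma> n s (\<sigma> n ?h v) = \<sigma> n (s \<otimes>\<^bsub>G\<^esub> ?h) v"
        using \<open>i < k\<close> niceD(2)[OF v S_in_wball[OF s(1)] wball_mono[OF h]] by simp
      also have "s \<otimes>\<^bsub>G\<^esub> ?h = g" using gc sc by (simp add: m_assoc[symmetric])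
      finally have "\<sigma> n s (\<sigma> n ?h v) = \<sigma> n s z" using g y by simp
      then have "z = \<sigma> n ?h v" using sigma_inj[OF sc] by simp
      then show ?thesis using h by auto
    qed
  qed
  then show "y \<in> (\<lambda>g. \<sigma> n g v) ` wball k" by (auto intro: wball_mono)
next
  have *: "\<sigma> n (wprod xs) v \<in> ballE S V \<sigma> n v (length xs)" if "set xs \<subseteq> S" "length xs \<le> k" for xs
    using that
  proof (induction xs)
    case Nil
    then show ?case using nice_one[OF v] ballE_self niceD(1)[OF v] by simp
  next
    case (Cons s xs)
    then have s: "s \<in> S" and xs: "set xs \<subseteq> S" "wprod xs \<in> wball k" using wballI[of xs k] by auto
    have "\<sigma> n (s \<otimes>\<^bsub>G\<^esub> wprod xs) v = \<sigma> n s (\<sigma> n (wprod xs) v)"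
      using niceD(2)[OF v S_in_wball[OF s] wball_mono[OF xs(2)]] by simp
    moreover have "\<sigma> n s (\<sigma> n (wprod xs) v) \<in> V n"
      using s S_carrier xs wprod_closed niceD(1)[OF v] by (intro sigma_in) auto
    ultimately show ?case
      using Cons s by (auto intro!: ballE_step[of "\<sigma> n (wprod xs) v"] simp: adjE_def)
  qed
  fix y assume "y \<in> (\<lambda>g. \<sigma> n g v) ` wball k"
  then obtain xs where "length xs \<le> k" "set xs \<subseteq> S" "y = \<sigma> n (wprod xs) v" by (auto elim!: wballE)
  then show "y \<in> ballE S V \<sigma> n v k" using *[of xs] by (auto intro: ballE_mono)
qed

text \<open>A generator times the label of a vertex in the ball may have length R + 1, and
  injectivity on that larger ball costs the factor 2.\<close>

lemma good_nice:
  assumes v: "nice V \<sigma> n (2 * Suc R) v"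
  shows "good G S V \<sigma> n R v"
proof -
  let ?f = "\<lambda>g. \<sigma> n g v"
  have inj: "inj_on ?f (wball R)"
    using nice_inj[OF nice_mono[OF v, of "2 * R"]] by (auto intro!: inj_onI)
  have ball: "ballE S V \<sigma> n v R = ?f ` wball R"
    by (rule ballE_nice[OF nice_mono[OF v]]) simp
  define \<phi> where "\<phi> = the_inv_into (wball R) ?f"
  have \<phi>: "\<phi> (\<sigma> n g v) = g" if "g \<in> wball R" for g
    unfolding \<phi>_def using inj that by (rule the_inv_into_f_f)
  have "bij_betw \<phi> (ballE S V \<sigma> n v R) (ballS G S \<one>\<^bsub>G\<^esub> R)"
    unfolding ball ballS_one \<phi>_def using inj by (intro bij_betw_the_inv_into) (simp add: bij_betw_def)
  moreover have "\<phi> v = \<one>\<^bsub>G\<^esub>" using \<phi>[OF one_in_wball] nice_one[OF v] by simp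
  moreover have "u' = \<sigma> n s u \<longleftrightarrow> \<phi> u' = s \<otimes>\<^bsub>G\<^esub> \<phi> u"
    if u: "u \<in> ballE S V \<sigma> n v R" and u': "u' \<in> ballE S V \<sigma> n v R" and s: "s \<in> S" for u u' s
  proof -
    obtain g g' where g: "g \<in> wball R" "u = \<sigma> n g v" and g': "g' \<in> wball R" "u' = \<sigma> n g' v"
      using u u' unfolding ball by auto
    have sg: "s \<otimes>\<^bsub>G\<^esub> g \<in> wball (Suc R)" using wball_mult[OF S_in_wball[OF s, of 0] g(1)] by simp
    have "\<sigma> n s u = \<sigma> n (s \<otimes>\<^bsub>G\<^esub> g) v"
      unfolding g(2) by (rule niceD(2)[OF v]) (use s g(1) S_in_wball[of s 0] wball_mono in auto)
    then show ?thesis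
      unfolding g(2) g'(2) \<phi>[OF g(1)] \<phi>[OF g'(1)]
      using nice_inj[OF v wball_mono[OF g'(1)] sg] by simp
  qed
  ultimately show ?thesis unfolding good_def using niceD(1)[OF v] by blast
qed

end

end

text \<open>On an empty \<open>V n\<close> the quotient is 0 / 0 = 0. Hence even the constant
  property \<open>True\<close> has content here: it says that \<open>V n\<close> is eventually
  nonempty.\<close>

definition almost_all :: "(nat \<Rightarrow> 'v set) \<Rightarrow> (nat \<Rightarrow> 'v \<Rightarrow> bool) \<Rightarrow> bool" where
  "almost_all V P \<longleftrightarrow> (\<lambda>n. real (card {v \<in> V n. P n v}) / real (card (V n))) \<longlonglongrightarrow> 1"

lemma ratio_le_one: "finite A \<Longrightarrow> real (card {v \<in> A. P v}) / real (card A) \<le> 1"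
  by (cases "card A = 0") (auto simp: divide_le_eq_1 card_gt_0_iff intro!: card_mono)

text \<open>Inclusion-exclusion: two subsets of V overlap in at least |P| + |Q| - |V|
  points.\<close>

lemma almost_all_conj:
  assumes "\<And>n. finite (V n)" "almost_all V P" "almost_all V Q"
  shows "almost_all V (\<lambda>n v. P n v \<and> Q n v)"
  unfolding almost_all_def
proof (rule tendsto_sandwich)
  let ?r = "\<lambda>P n. real (card {v \<in> V n. P n v}) / real (card (V n))"
  show "(\<lambda>n. ?r P n + ?r Q n - 1) \<longlonglongrightarrow> 1"
    using tendsto_diff[OF tendsto_add[OF assms(2,3)[unfolded almost_all_def]] tendsto_const[of 1]] by simp
  show "\<forall>\<^sub>F n in sequentially. ?r (\<lambda>n v. P n v \<and> Q n v) n \<le> 1"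
    by (intro always_eventually allI ratio_le_one assms(1))
  show "\<forall>\<^sub>F n in sequentially. ?r P n + ?r Q n - 1 \<le> ?r (\<lambda>n v. P n v \<and> Q n v) n"
  proof (intro always_eventually allI)
    fix n
    have "card {v \<in> V n. P n v} + card {v \<in> V n. Q n v}
        = card ({v \<in> V n. P n v} \<union> {v \<in> V n. Q n v}) + card ({v \<in> V n. P n v} \<inter> {v \<in> V n. Q n v})"
      using assms(1) by (intro card_Un_Int) auto
    also have "\<dots> \<le> card (V n) + card {v \<in> V n. P n v \<and> Q n v}"
      using assms(1) by (intro add_mono card_mono) auto
    finally have "real (card {v \<in> V n. P n v}) + real (card {v \<in> V n. Q n v})
       \<le> real (card (V n)) + real (card {v \<in> V n. P n v \<and> Q n v})" by linarith
    then have "(real (card {v \<in> V n. P n v}) + real (card {v \<in> V n. Q n v}) - real (card (V n))) / real (card (V n))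
        \<le> ?r (\<lambda>n v. P n v \<and> Q n v) n"
      by (intro divide_right_mono) auto
    \<comment> \<open>For empty \<open>V n\<close> the inequality reads -1 <= 0.\<close>
    then show "?r P n + ?r Q n - 1 \<le> ?r (\<lambda>n v. P n v \<and> Q n v) n"
      by (cases "card (V n) = 0") (simp_all add: add_divide_distrib diff_divide_distrib)
  qed
qed simp

text \<open>The assumption on \<open>True\<close> is the case of an empty index set.\<close>

lemma almost_all_ball:
  assumes "\<And>n. finite (V n)" "almost_all V (\<lambda>_ _. True)" "finite I" "\<And>i. i \<in> I \<Longrightarrow> almost_all V (P i)"
  shows "almost_all V (\<lambda>n v. \<forall>i\<in>I. P i n v)"
  using assms(3,4)
proof (induction I)
  case (insert i I)
  then have "almost_all V (\<lambda>n v. P i n v \<and> (\<forall>j\<in>I. P j n v))"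
    by (intro almost_all_conj assms(1)) auto
  then show ?case by simp
qed (simp add: assms(2))

context fg_sym
begin

lemma almost_all_nice:
  assumes "sofic_approx G V \<sigma>"
  shows "almost_all V (\<lambda>n. nice V \<sigma> n k)"
proof -
  have fin: "finite (V n)" for n using assms by (simp add: sofic_approx_def)
  have mult: "almost_all V (\<lambda>n v. \<sigma> n g (\<sigma> n h v) = \<sigma> n (g \<otimes>\<^bsub>G\<^esub> h) v)"
    if "g \<in> carrier G" "h \<in> carrier G" for g h
    using assms that by (simp add: sofic_approx_def almost_all_def)
  have free: "almost_all V (\<lambda>n v. g \<noteq> \<one>\<^bsub>G\<^esub> \<longrightarrow> \<sigma> n g v \<noteq> v)" if "g \<in> carrier G" for g
  proof (cases "g = \<one>\<^bsub>G\<^esub>")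
    case True
    \<comment> \<open>Eventual nonemptiness comes from multiplicativity at the identity, whose ratio
      would be 0 on an empty set.\<close>
    have triv: "almost_all V (\<lambda>n v. True)"
      unfolding almost_all_def
    proof (rule tendsto_sandwich[OF _ _ mult[OF one_closed one_closed, unfolded almost_all_def] tendsto_const])
      show "\<forall>\<^sub>F n in sequentially. real (card {v \<in> V n. \<sigma> n \<one>\<^bsub>G\<^esub> (\<sigma> n \<one>\<^bsub>G\<^esub> v) = \<sigma> n (\<one>\<^bsub>G\<^esub> \<otimes>\<^bsub>G\<^esub> \<one>\<^bsub>G\<^esub>) v}) / real (card (V n))
         \<le> real (card {v \<in> V n. True}) / real (card (V n))"
        using fin by (intro always_eventually allI divide_right_mono) (auto intro!: card_mono)
      show "\<forall>\<^sub>F n in sequentially. real (card {v \<in> V n. True}) / real (card (V n)) \<le> 1"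
        by (intro always_eventually allI ratio_le_one fin)
    qed
    then show ?thesis using True by simp
  next
    case False
    then show ?thesis using assms that by (simp add: sofic_approx_def almost_all_def)
  qed
  have triv: "almost_all V (\<lambda>n v. True)" using free[OF one_closed] by simp
  have "almost_all V (\<lambda>n v. (\<forall>g\<in>wball k. \<forall>h\<in>wball k. \<sigma> n g (\<sigma> n h v) = \<sigma> n (g \<otimes>\<^bsub>G\<^esub> h) v) \<and>
     (\<forall>g\<in>wball k. g \<noteq> \<one>\<^bsub>G\<^esub> \<longrightarrow> \<sigma> n g v \<noteq> v))"
    using finite_wball mult free wball_carrier by (intro almost_all_conj almost_all_ball fin triv) auto
  moreover have "{v \<in> V n. nice V \<sigma> n k v} = {v \<in> V n. (\<forall>g\<in>wball k. \<forall>h\<in>wball k. \<sigma> n g (\<sigma> n h v) = \<sigma> n (g \<otimes>\<^bsub>G\<^esub> h) v) \<and>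
     (\<forall>g\<in>wball k. g \<noteq> \<one>\<^bsub>G\<^esub> \<longrightarrow> \<sigma> n g v \<noteq> v)}" for n by (auto simp: nice_def)
  ultimately show ?thesis by (simp add: almost_all_def)
qed

lemma wball_translate_iff:
  assumes "x \<in> carrier G" "y \<in> carrier G"
  shows "y \<in> (\<lambda>a. a \<otimes>\<^bsub>G\<^esub> x) ` wball k \<longleftrightarrow> y \<otimes>\<^bsub>G\<^esub> inv\<^bsub>G\<^esub> x \<in> wball k"
proof
  assume "y \<otimes>\<^bsub>G\<^esub> inv\<^bsub>G\<^esub> x \<in> wball k"
  then show "y \<in> (\<lambda>a. a \<otimes>\<^bsub>G\<^esub> x) ` wball k"
    using assms by (intro image_eqI[of _ _ "y \<otimes>\<^bsub>G\<^esub> inv\<^bsub>G\<^esub> x"]) (auto simp: m_assoc)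
next
  assume "y \<in> (\<lambda>a. a \<otimes>\<^bsub>G\<^esub> x) ` wball k"
  then show "y \<otimes>\<^bsub>G\<^esub> inv\<^bsub>G\<^esub> x \<in> wball k"
    using assms wball_carrier by (auto simp: m_assoc)
qed

lemma shift_in_topspace: "shift G g \<omega> \<in> topspace (XG G)"
  by (simp add: topspace_XG shift_def)

lemma PiV_in_topspace: "PiV G \<sigma> n v \<rho> \<in> topspace (XG G)"
  by (simp add: topspace_XG PiV_def)

section \<open>Powers of a continuous operator on the group\<close>

context
  fixes H :: "('g \<Rightarrow> 'x::metric_space) \<Rightarrow> 'g \<Rightarrow> 'g \<Rightarrow> complex" and M :: nat
  assumes op: "continuous_operator G S M H"
begin

lemma H_shift:
  assumes "\<omega> \<in> topspace (XG G)" "x \<in> carrier G" "y \<in> carrier G" "g \<in> carrier G"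
  shows "H \<omega> (x \<otimes>\<^bsub>G\<^esub> g) (y \<otimes>\<^bsub>G\<^esub> g) = H (shift G g \<omega>) x y"
  using op assms by (simp add: continuous_operator_def)

lemma H_zero:
  assumes "\<omega> \<in> topspace (XG G)" "x \<in> carrier G" "y \<in> carrier G" "y \<otimes>\<^bsub>G\<^esub> inv\<^bsub>G\<^esub> x \<notin> wball M"
  shows "H \<omega> x y = 0"
proof -
  have "dS G S x y > M" using assms dS_le_iff[of x y M] by (simp add: not_le[symmetric])
  then show ?thesis using op assms by (simp add: continuous_operator_def)
qed

text \<open>Finite range confines row x to the translates a x. The index set \<open>wball M\<close>
  does not depend on omega, so continuity of powers in omega reduces to finite sums and
  products.\<close>

lemma kpow_Suc_H:
  assumes \<omega>: "\<omega> \<in> topspace (XG G)" and x: "x \<in> carrier G"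
  shows "kpow (carrier G) (H \<omega>) (Suc j) x z
       = (\<Sum>a\<in>wball M. H \<omega> x (a \<otimes>\<^bsub>G\<^esub> x) * kpow (carrier G) (H \<omega>) j (a \<otimes>\<^bsub>G\<^esub> x) z)"
proof -
  let ?h = "\<lambda>y. H \<omega> x y * kpow (carrier G) (H \<omega>) j y z"
  have "kpow (carrier G) (H \<omega>) (Suc j) x z = infsum ?h (carrier G)" by (simp add: kmult_def)
  also have "\<dots> = infsum ?h ((\<lambda>a. a \<otimes>\<^bsub>G\<^esub> x) ` wball M)"
  proof (rule infsum_cong_neutral)
    fix y assume "y \<in> carrier G - (\<lambda>a. a \<otimes>\<^bsub>G\<^esub> x) ` wball M"
    then have "H \<omega> x y = 0" using wball_translate_iff[of x y M] x \<omega> by (intro H_zero) auto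
    then show "?h y = 0" by simp
  qed (use x wball_carrier in auto)
  also have "\<dots> = sum ?h ((\<lambda>a. a \<otimes>\<^bsub>G\<^esub> x) ` wball M)" using finite_wball by simp
  also have "\<dots> = (\<Sum>a\<in>wball M. ?h (a \<otimes>\<^bsub>G\<^esub> x))"
    using x wball_carrier by (intro sum.reindex_cong[of "\<lambda>a. a \<otimes>\<^bsub>G\<^esub> x"] inj_onI) auto
  finally show ?thesis .
qed

lemma continuous_kpow:
  assumes "x \<in> carrier G"
  shows "continuous_map (XG G) euclidean (\<lambda>\<omega>. kpow (carrier G) (H \<omega>) j x z)"
  using assms
proof (induction j arbitrary: x)
  case 0
  then show ?case by simp
next
  case (Suc j)
  let ?h = "\<lambda>\<omega>. \<Sum>a\<in>wball M. H \<omega> x (a \<otimes>\<^bsub>G\<^esub> x) * kpow (carrier G) (H \<omega>) j (a \<otimes>\<^bsub>G\<^esub> x) z"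
  have "continuous_map (XG G) euclidean ?h"
    unfolding continuous_map_atin limitin_canonical_iff
  proof (intro ballI tendsto_sum tendsto_mult)
    fix \<omega> :: "'g \<Rightarrow> 'x" and a assume \<omega>: "\<omega> \<in> topspace (XG G)" and a: "a \<in> wball M"
    then have ax: "a \<otimes>\<^bsub>G\<^esub> x \<in> carrier G" using Suc.prems wball_carrier by simp
    have "continuous_map (XG G) euclidean (\<lambda>\<omega>. H \<omega> x (a \<otimes>\<^bsub>G\<^esub> x))"
      using op Suc.prems ax by (simp add: continuous_operator_def)
    then show "((\<lambda>\<omega>. H \<omega> x (a \<otimes>\<^bsub>G\<^esub> x)) \<longlongrightarrow> H \<omega> x (a \<otimes>\<^bsub>G\<^esub> x)) (atin (XG G) \<omega>)"
      using \<omega> by (simp add: continuous_map_atin)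
    show "((\<lambda>\<omega>. kpow (carrier G) (H \<omega>) j (a \<otimes>\<^bsub>G\<^esub> x) z) \<longlongrightarrow> kpow (carrier G) (H \<omega>) j (a \<otimes>\<^bsub>G\<^esub> x) z) (atin (XG G) \<omega>)"
      using \<omega> Suc.IH[OF ax] by (simp add: continuous_map_atin)
  qed
  then show ?case
    by (rule continuous_map_eq) (simp add: kpow_Suc_H[OF _ Suc.prems] del: kpow.simps)
qed

text \<open>Equivariance moves each entry within range to H(e, a) at a shifted configuration, with a
  in \<open>wball M\<close>. That leaves finitely many continuous functions on a compact
  space.\<close>

lemma H_bounded:
  assumes "compact (UNIV :: 'x set)"
  obtains B where "B \<ge> 0"
    "\<And>(\<omega> :: 'g \<Rightarrow> 'x) x y. \<omega> \<in> topspace (XG G) \<Longrightarrow> x \<in> carrier G \<Longrightarrow> y \<in> carrier G \<Longrightarrow> cmod (H \<omega> x y) \<le> B"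
proof -
  have "\<exists>b. \<forall>\<omega>\<in>topspace (XG G). cmod (H \<omega> \<one>\<^bsub>G\<^esub> a) \<le> b" if "a \<in> carrier G" for a
  proof -
    have "continuous_map (XG G) euclidean (\<lambda>\<omega>. H \<omega> \<one>\<^bsub>G\<^esub> a)"
      using op that by (simp add: continuous_operator_def)
    from continuous_map_XG_bounded[OF assms this] show ?thesis by metis
  qed
  then obtain b where b: "\<And>a \<omega>. a \<in> carrier G \<Longrightarrow> \<omega> \<in> topspace (XG G) \<Longrightarrow> cmod (H \<omega> \<one>\<^bsub>G\<^esub> a) \<le> b a"
    by metis
  define B where "B = (\<Sum>a\<in>wball M. \<bar>b a\<bar>)"
  have B: "B \<ge> 0" by (simp add: B_def sum_nonneg)
  have "cmod (H \<omega> x y) \<le> B" if \<omega>: "\<omega> \<in> topspace (XG G)" and xy: "x \<in> carrier G" "y \<in> carrier G" for \<omega> x y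
  proof (cases "y \<otimes>\<^bsub>G\<^esub> inv\<^bsub>G\<^esub> x \<in> wball M")
    case True
    let ?a = "y \<otimes>\<^bsub>G\<^esub> inv\<^bsub>G\<^esub> x"
    have "H \<omega> x y = H (shift G x \<omega>) \<one>\<^bsub>G\<^esub> ?a"
      using H_shift[OF \<omega>, of "\<one>\<^bsub>G\<^esub>" ?a x] xy by (simp add: m_assoc)
    also have "cmod \<dots> \<le> \<bar>b ?a\<bar>"
      using b[OF wball_carrier[OF True] shift_in_topspace[of x \<omega>]] by linarith
    also have "\<dots> \<le> B" unfolding B_def using True finite_wball by (intro member_le_sum) auto
    finally show ?thesis .
  qed (use H_zero[OF \<omega> xy] B in simp)
  with B show ?thesis by (rule that)
qed

lemma banded_kernel_H:
  assumes \<omega>: "\<omega> \<in> topspace (XG G)"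
    and B: "\<And>x y. x \<in> carrier G \<Longrightarrow> y \<in> carrier G \<Longrightarrow> cmod (H \<omega> x y) \<le> B"
    and D: "card (wball M) \<le> D"
  shows "banded_kernel (carrier G) (H \<omega>) (\<lambda>x. (\<lambda>a. a \<otimes>\<^bsub>G\<^esub> x) ` wball M) D B"
proof
  show "H \<omega> z y = cnj (H \<omega> y z)" if "y \<in> carrier G" "z \<in> carrier G" for y z
    using op \<omega> that unfolding continuous_operator_def selfadjoint_kernel_def by blast
  show "card ((\<lambda>a. a \<otimes>\<^bsub>G\<^esub> y) ` wball M) \<le> D" for y
    using card_image_le[OF finite_wball] D by (rule order_trans)
  show "H \<omega> y z = 0" if "y \<in> carrier G" "z \<in> carrier G" "z \<notin> (\<lambda>a. a \<otimes>\<^bsub>G\<^esub> y) ` wball M" for y z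
    using that wball_translate_iff[of y z M] \<omega> by (intro H_zero) auto
qed (use finite_wball wball_carrier B in auto)

section \<open>The finite operators near a nice vertex\<close>

context
  fixes V :: "nat \<Rightarrow> 'v set" and \<sigma> :: "nat \<Rightarrow> 'g \<Rightarrow> 'v \<Rightarrow> 'v" and Hn :: "nat \<Rightarrow> ('v \<Rightarrow> 'x) \<Rightarrow> 'v \<Rightarrow> 'v \<Rightarrow> complex"
  assumes fin: "\<And>n. finite (V n)"
    and perm: "\<And>n. \<forall>g\<in>carrier G. \<sigma> n g permutes V n"
    and weak: "weak_approx G S V \<sigma> M H Hn"
    and hom_or_bounded: "(\<forall>n. \<forall>g\<in>carrier G. \<forall>h\<in>carrier G. \<forall>v\<in>V n. \<sigma> n (g \<otimes>\<^bsub>G\<^esub> h) v = \<sigma> n g (\<sigma> n h v))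
         \<or> bounded_interaction G S M H"
begin

private lemmas sigma_in_V = sigma_in[where V = V and \<sigma> = \<sigma>, OF perm]
  and nice_one_V = nice_one[where V = V and \<sigma> = \<sigma>, OF perm]
  and nice_inj_V = nice_inj[where V = V and \<sigma> = \<sigma>, OF perm]
  and nice_translate_V = nice_translate[where V = V and \<sigma> = \<sigma>, OF perm]
  and ballE_nice_V = ballE_nice[where V = V and \<sigma> = \<sigma>, OF perm]
  and good_nice_V = good_nice[where V = V and \<sigma> = \<sigma>, OF perm]

text \<open>The radius leaves niceness \<open>2 * Suc (4 * M)\<close> at the translate by g, which
  is what \<open>good_nice\<close> needs for 4M-goodness. The approximation property then gives H at
  the configuration seen from the translate, which still has to be replaced by the shift by g of the
  one seen from v.\<close>

lemma Hn_local:
  assumes v: "nice V \<sigma> n k v" and k: "2 * (2 * Suc (4 * M) + l) \<le> k" and g: "g \<in> wball l" and a: "a \<in> wball M"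
    and \<rho>: "\<rho> \<in> space (PiM (V n) (\<lambda>_. borel))"
  shows "Hn n \<rho> (\<sigma> n g v) (\<sigma> n a (\<sigma> n g v)) = H (PiV G \<sigma> n v \<rho>) g (a \<otimes>\<^bsub>G\<^esub> g)"
proof -
  let ?w = "\<sigma> n g v" and ?\<omega> = "PiV G \<sigma> n v \<rho>"
  have gc: "g \<in> carrier G" and ac: "a \<in> carrier G" using g a wball_carrier by auto
  have w: "nice V \<sigma> n (2 * Suc (4 * M)) ?w"
    using nice_mono[OF v k] g by (rule nice_translate_V)
  have "\<sigma> n a ?w \<in> ballE S V \<sigma> n ?w M"
    using a ballE_nice_V[OF nice_mono[OF w, of "Suc M"]] by auto
  moreover have "good G S V \<sigma> n (4 * M) ?w" by (rule good_nice_V[OF w])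
  ultimately have "Hn n \<rho> ?w (\<sigma> n a ?w) = H (PiV G \<sigma> n ?w \<rho>) \<one>\<^bsub>G\<^esub> a"
    using weak \<rho> a unfolding weak_approx_def wball_def by blast
  also have "\<dots> = H (shift G g ?\<omega>) \<one>\<^bsub>G\<^esub> a"
    using hom_or_bounded
  proof
    assume hom: "\<forall>n. \<forall>g\<in>carrier G. \<forall>h\<in>carrier G. \<forall>v\<in>V n. \<sigma> n (g \<otimes>\<^bsub>G\<^esub> h) v = \<sigma> n g (\<sigma> n h v)"
    have "PiV G \<sigma> n ?w \<rho> = shift G g ?\<omega>"
      using hom gc niceD(1)[OF v] by (auto simp: PiV_def shift_def restrict_def)
    then show ?thesis by simp
  next
    assume bi: "bounded_interaction G S M H"
    \<comment> \<open>Agreement is available only on \<open>wball M\<close>, where niceness of v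
      supplies multiplicativity; bounded interaction asks for no more.\<close>
    have "PiV G \<sigma> n ?w \<rho> h = shift G g ?\<omega> h" if "h \<in> wball M" for h
    proof -
      have "\<sigma> n h ?w = \<sigma> n (h \<otimes>\<^bsub>G\<^esub> g) v"
        using that g k by (intro niceD(2)[OF v]) (auto intro: wball_mono)
      then show ?thesis using wball_carrier[OF that] gc by (simp add: PiV_def shift_def)
    qed
    then show ?thesis
      by (intro bi[unfolded bounded_interaction_def ballS_one, rule_format, OF PiV_in_topspace shift_in_topspace] ac)
  qed
  also have "\<dots> = H ?\<omega> g (a \<otimes>\<^bsub>G\<^esub> g)"
    using H_shift[OF PiV_in_topspace[of \<sigma> n v \<rho>] one_closed ac gc] gc by simp
  finally show ?thesis .
qed

text \<open>The recursion for powers moves the row index and keeps the column at v, so the claim is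
  made for every translate of v. Each factor moves the row by at most M, and
  \<open>i + j * M\<close> is the room required to stay within radius l.\<close>

lemma kpow_Hn_local:
  assumes v: "nice V \<sigma> n k v" and k: "2 * (2 * Suc (4 * M) + l) \<le> k"
    and \<rho>: "\<rho> \<in> space (PiM (V n) (\<lambda>_. borel))"
  shows "i + j * M \<le> l \<Longrightarrow> g \<in> wball i \<Longrightarrow>
    kpow (V n) (Hn n \<rho>) j (\<sigma> n g v) v = kpow (carrier G) (H (PiV G \<sigma> n v \<rho>)) j g \<one>\<^bsub>G\<^esub>"
proof (induction j arbitrary: g i)
  case 0
  \<comment> \<open>Both sides are Kronecker deltas; freeness at v makes them agree.\<close>
  have "\<sigma> n g v = v \<longleftrightarrow> g = \<one>\<^bsub>G\<^esub>"
    using niceD(3)[OF v, of g] nice_one_V[OF v] wball_mono[OF 0(2), of k] 0 k by auto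
  then show ?case by simp
next
  case (Suc j)
  let ?w = "\<sigma> n g v" and ?\<omega> = "PiV G \<sigma> n v \<rho>"
  have g: "g \<in> wball l" using wball_mono[OF Suc.prems(2)] Suc.prems(1) by simp
  have gc: "g \<in> carrier G" using g wball_carrier by auto
  have wV: "?w \<in> V n" using sigma_in_V[OF gc niceD(1)[OF v]] .
  have w: "nice V \<sigma> n (2 * Suc (4 * M)) ?w"
    using nice_mono[OF v k] g by (rule nice_translate_V)
  have ball: "ballE S V \<sigma> n ?w M = (\<lambda>a. \<sigma> n a ?w) ` wball M"
    by (rule ballE_nice_V[OF nice_mono[OF w]]) auto
  have inj: "inj_on (\<lambda>a. \<sigma> n a ?w) (wball M)"
    using nice_inj_V[OF nice_mono[OF w, of "2 * M"]] by (auto intro!: inj_onI)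
  have "kpow (V n) (Hn n \<rho>) (Suc j) ?w v = (\<Sum>y\<in>V n. Hn n \<rho> ?w y * kpow (V n) (Hn n \<rho>) j y v)"
    using fin by (simp add: kmult_def)
  also have "\<dots> = (\<Sum>y\<in>ballE S V \<sigma> n ?w M. Hn n \<rho> ?w y * kpow (V n) (Hn n \<rho>) j y v)"
    using weak \<rho> wV fin by (intro sum.mono_neutral_right) (auto simp: weak_approx_def ballE_def)
  also have "\<dots> = (\<Sum>a\<in>wball M. Hn n \<rho> ?w (\<sigma> n a ?w) * kpow (V n) (Hn n \<rho>) j (\<sigma> n a ?w) v)"
    unfolding ball using inj by (simp add: sum.reindex)
  also have "\<dots> = (\<Sum>a\<in>wball M. H ?\<omega> g (a \<otimes>\<^bsub>G\<^esub> g) * kpow (carrier G) (H ?\<omega>) j (a \<otimes>\<^bsub>G\<^esub> g) \<one>\<^bsub>G\<^esub>)"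
  proof (rule sum.cong[OF refl])
    fix a assume a: "a \<in> wball M"
    have "\<sigma> n a ?w = \<sigma> n (a \<otimes>\<^bsub>G\<^esub> g) v"
      using a g k by (intro niceD(2)[OF v]) (auto intro: wball_mono)
    moreover have "a \<otimes>\<^bsub>G\<^esub> g \<in> wball (M + i)" by (rule wball_mult[OF a Suc.prems(2)])
    ultimately have "kpow (V n) (Hn n \<rho>) j (\<sigma> n a ?w) v = kpow (carrier G) (H ?\<omega>) j (a \<otimes>\<^bsub>G\<^esub> g) \<one>\<^bsub>G\<^esub>"
      using Suc.IH[of "M + i" "a \<otimes>\<^bsub>G\<^esub> g"] Suc.prems(1) by simp
    then show "Hn n \<rho> ?w (\<sigma> n a ?w) * kpow (V n) (Hn n \<rho>) j (\<sigma> n a ?w) v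
        = H ?\<omega> g (a \<otimes>\<^bsub>G\<^esub> g) * kpow (carrier G) (H ?\<omega>) j (a \<otimes>\<^bsub>G\<^esub> g) \<one>\<^bsub>G\<^esub>"
      using Hn_local[OF v k g a \<rho>] by simp
  qed
  also have "\<dots> = kpow (carrier G) (H ?\<omega>) (Suc j) g \<one>\<^bsub>G\<^esub>"
    by (rule kpow_Suc_H[OF PiV_in_topspace gc, symmetric])
  finally show ?case .
qed

lemma kpow_Hn_diag_local:
  assumes v: "nice V \<sigma> n k v" and k: "2 * (2 * Suc (4 * M) + j * M) \<le> k"
    and \<rho>: "\<rho> \<in> space (PiM (V n) (\<lambda>_. borel))"
  shows "kpow (V n) (Hn n \<rho>) j v v = kpow (carrier G) (H (PiV G \<sigma> n v \<rho>)) j \<one>\<^bsub>G\<^esub> \<one>\<^bsub>G\<^esub>"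
  using kpow_Hn_local[OF v k \<rho>, of 0 j "\<one>\<^bsub>G\<^esub>"] nice_one_V[OF v] one_in_wball by simp

lemma banded_kernel_Hn:
  assumes \<rho>: "\<rho> \<in> space (PiM (V n) (\<lambda>_. borel))"
    and B: "\<And>x y. x \<in> V n \<Longrightarrow> y \<in> V n \<Longrightarrow> cmod (Hn n \<rho> x y) \<le> B"
    and D: "(1 + 2 * card S) ^ M \<le> D"
  shows "banded_kernel (V n) (Hn n \<rho>) (\<lambda>v. ballE S V \<sigma> n v M) D B"
proof
  show sub: "ballE S V \<sigma> n y M \<subseteq> V n" for y by (auto simp: ballE_def)
  show "finite (ballE S V \<sigma> n y M)" for y using sub fin by (rule finite_subset)
  show "Hn n \<rho> z y = cnj (Hn n \<rho> y z)" if "y \<in> V n" "z \<in> V n" for y z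
    using weak \<rho> that unfolding weak_approx_def selfadjoint_kernel_def by blast
  have "card (ballE S V \<sigma> n y M) \<le> (1 + 2 * card S) ^ M" for y
    using S_carrier perm permutes_inj by (intro card_ballE_le S_finite fin) blast
  then show "card (ballE S V \<sigma> n y M) \<le> D" for y using D by (rule order_trans)
  show "Hn n \<rho> y z = 0" if "y \<in> V n" "z \<in> V n" "z \<notin> ballE S V \<sigma> n y M" for y z
    using weak \<rho> that by (auto simp: weak_approx_def)
qed (rule B)

lemma measurable_kpow_Hn:
  assumes "x \<in> V n" "z \<in> V n"
  shows "(\<lambda>\<rho>. kpow (V n) (Hn n \<rho>) j x z) \<in> borel_measurable (PiM (V n) (\<lambda>_. borel))"
  using assms(1)
proof (induction j arbitrary: x)
  case (Suc j)
  have "(\<lambda>\<rho>. \<Sum>y\<in>V n. Hn n \<rho> x y * kpow (V n) (Hn n \<rho>) j y z) \<in> borel_measurable (PiM (V n) (\<lambda>_. borel))"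
    using Suc weak by (intro borel_measurable_sum borel_measurable_times) (auto simp: weak_approx_def)
  then show ?case using fin by (simp add: kmult_def)
qed simp

end

end

end

section \<open>Convergence of the density of states in measure\<close>

theorem mainTheorem1:
  fixes G :: "('g, 'b) monoid_scheme" and S :: "'g set"
    and \<mu> :: "('g \<Rightarrow> 'x::metric_space) measure"
    and V :: "nat \<Rightarrow> 'v set" and \<sigma> :: "nat \<Rightarrow> 'g \<Rightarrow> 'v \<Rightarrow> 'v"
    and \<mu>s :: "nat \<Rightarrow> ('v \<Rightarrow> 'x) measure"
    and M :: nat and H :: "('g \<Rightarrow> 'x) \<Rightarrow> 'g \<Rightarrow> 'g \<Rightarrow> complex"
    and Hn :: "nat \<Rightarrow> ('v \<Rightarrow> 'x) \<Rightarrow> 'v \<Rightarrow> 'v \<Rightarrow> complex"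
    and \<epsilon> :: real and f :: "real \<Rightarrow> real"
  assumes "fg_sym_group G S"
    and "compact (UNIV :: 'x set)"
    and "G_process G \<mu>"
    and "ergodically_sofic_model G V \<sigma> \<mu>s \<mu>"
    and "continuous_operator G S M H"
    and "(\<forall>n. \<forall>g\<in>carrier G. \<forall>h\<in>carrier G. \<forall>v\<in>V n. \<sigma> n (g \<otimes>\<^bsub>G\<^esub> h) v = \<sigma> n g (\<sigma> n h v))
         \<or> bounded_interaction G S M H"
    and "induced_approx G S V \<sigma> M H Hn"
    and "\<epsilon> > 0"
    and "continuous_on UNIV f" and "bounded (range f)"
  shows "(\<lambda>n. measure (\<mu>s n) {\<rho> \<in> space (\<mu>s n). \<bar>theta_n V Hn n \<rho> f - IDS G H \<mu> f\<bar> < \<epsilon>})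
           \<longlonglongrightarrow> 1"
proof -
  interpret fg_sym G S by unfold_locales fact
  note comp = assms(2) and op = assms(5) and f = \<open>continuous_on UNIV f\<close>
  have sofic: "sofic_approx G V \<sigma>" and le: "loc_emp G V \<sigma> \<mu>s \<mu>"
    and \<mu>s: "\<And>n. prob_space (\<mu>s n)" "\<And>n. sets (\<mu>s n) = sets (PiM (V n) (\<lambda>_. borel))"
    using assms(4) by (auto simp: ergodically_sofic_model_def)
  have fin: "finite (V n)" and perm: "\<forall>g\<in>carrier G. \<sigma> n g permutes V n" for n
    using sofic by (auto simp: sofic_approx_def)
  have weak: "weak_approx G S V \<sigma> M H Hn" using assms(7) by (simp add: induced_approx_def)
  have \<mu>: "prob_space \<mu>" and sets_\<mu>: "sets \<mu> = sets (PiM (carrier G) (\<lambda>_. borel))"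
    using assms(3) by (auto simp: G_process_def)
  interpret \<mu>: prob_space \<mu> by (rule \<mu>)
  have space_\<mu>: "space \<mu> = topspace (XG G)"
    using sets_eq_imp_space_eq[OF sets_\<mu>] by (simp add: topspace_XG space_PiM_borel)
  have space_\<mu>s: "space (\<mu>s n) = space (PiM (V n) (\<lambda>_. borel))" for n
    by (rule sets_eq_imp_space_eq[OF \<mu>s(2)])

  obtain B where B: "B \<ge> 0" "\<And>(\<omega> :: 'g \<Rightarrow> 'x) x y. \<omega> \<in> topspace (XG G) \<Longrightarrow> x \<in> carrier G \<Longrightarrow> y \<in> carrier G \<Longrightarrow> cmod (H \<omega> x y) \<le> B"
    using H_bounded[OF op comp] by metis
  \<comment> \<open>The induced condition makes \<open>B\<close> valid also at vertices that are not
    good, where a weak approximation does not tie the entries to H.\<close>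
  have Bn: "cmod (Hn n \<rho> x y) \<le> B" if "\<rho> \<in> space (PiM (V n) (\<lambda>_. borel))" "x \<in> V n" "y \<in> V n" for n \<rho> x y
  proof -
    have "Hn n \<rho> x y \<in> {H \<omega> x y | \<omega> x y. \<omega> \<in> topspace (XG G) \<and> x \<in> carrier G \<and> y \<in> carrier G} \<union> {0}"
      using assms(7) that unfolding induced_approx_def by blast
    then show ?thesis using B by auto
  qed
  \<comment> \<open>A common row-size bound for the group and all finite graphs, so that a single C
    serves both.\<close>
  define D where "D = max (card (wball M)) ((1 + 2 * card S) ^ M)"
  \<comment> \<open>The summand 1 keeps C positive when B = 0.\<close>
  define C where "C = B * D + 1"
  have C: "C > 0" "B * D \<le> C" using B by (auto simp: C_def add_nonneg_pos)
  have bkG: "banded_kernel (carrier G) (H \<omega>) (\<lambda>x. (\<lambda>a. a \<otimes>\<^bsub>G\<^esub> x) ` wball M) D B" if "\<omega> \<in> topspace (XG G)" for \<omega>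
    using that B(2) by (intro banded_kernel_H[OF op]) (auto simp: D_def)
  have bkV: "banded_kernel (V n) (Hn n \<rho>) (\<lambda>v. ballE S V \<sigma> n v M) D B"
    if "\<rho> \<in> space (PiM (V n) (\<lambda>_. borel))" for n \<rho>
    using that Bn by (intro banded_kernel_Hn[OF op fin perm weak assms(6)]) (auto simp: D_def)

  define F where "F a m \<omega> = (\<Sum>i\<le>m. a i * Re (kpow (carrier G) (H \<omega>) i \<one>\<^bsub>G\<^esub> \<one>\<^bsub>G\<^esub>))"
    for a :: "nat \<Rightarrow> real" and m :: nat and \<omega>
  define Fn where "Fn a m n \<rho> v = (\<Sum>i\<le>m. a i * Re (kpow (V n) (Hn n \<rho>) i v v))"
    for a :: "nat \<Rightarrow> real" and m n :: nat and \<rho> v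
  define T where "T a m n \<rho> = (\<Sum>v\<in>V n. Fn a m n \<rho> v) / real (card (V n))" for a m n \<rho>
  let ?approx = "\<lambda>a m \<delta>. \<forall>t. \<bar>t\<bar> \<le> C \<longrightarrow> \<bar>f t - (\<Sum>i\<le>m. a i * t ^ i)\<bar> \<le> \<delta>"

  have theta_F: "\<bar>theta G H \<omega> f - F a m \<omega>\<bar> \<le> \<delta>" if "\<omega> \<in> topspace (XG G)" "?approx a m \<delta>" for \<omega> a m \<delta>
    unfolding theta_def F_def
    using that(2) by (intro banded_kernel.spec_meas_polynomial_approx[OF bkG[OF that(1)] one_closed C f]) auto
  have theta_n_T: "\<bar>theta_n V Hn n \<rho> f - T a m n \<rho>\<bar> \<le> \<delta>"
    if \<rho>: "\<rho> \<in> space (PiM (V n) (\<lambda>_. borel))" and a: "?approx a m \<delta>" for n \<rho> a m \<delta>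
  proof -
    \<comment> \<open>Testing the approximation at t = 0 yields nonnegativity of \<delta>, which
      settles the case of empty \<open>V n\<close>, where both averages are 0.\<close>
    have "0 \<le> \<bar>f 0 - (\<Sum>i\<le>m. a i * 0 ^ i)\<bar>" by simp
    also have "\<dots> \<le> \<delta>" using C(1) by (intro a[rule_format]) simp
    finally have \<delta>: "\<delta> \<ge> 0" .
    have "\<bar>(\<integral>t. f t \<partial>spec_meas (V n) (Hn n \<rho>) v) - Fn a m n \<rho> v\<bar> \<le> \<delta>" if "v \<in> V n" for v
      unfolding Fn_def
      using a by (intro banded_kernel.spec_meas_polynomial_approx[OF bkV[OF \<rho>] that C f]) auto
    then have "\<bar>\<Sum>v\<in>V n. (\<integral>t. f t \<partial>spec_meas (V n) (Hn n \<rho>) v) - Fn a m n \<rho> v\<bar> \<le> (\<Sum>v\<in>V n. \<delta>)"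
      by (intro order_trans[OF sum_abs] sum_mono)
    then have "\<bar>(\<Sum>v\<in>V n. (\<integral>t. f t \<partial>spec_meas (V n) (Hn n \<rho>) v) - Fn a m n \<rho> v) / real (card (V n))\<bar> \<le> \<delta>"
      using \<delta> by (cases "card (V n) = 0") (simp_all add: divide_le_eq mult.commute)
    then show ?thesis by (simp add: theta_n_def T_def sum_subtractf diff_divide_distrib)
  qed

  \<comment> \<open>These approximations of increasing precision serve measurability:
    \<open>theta\<close> and \<open>theta_n\<close> become pointwise limits of polynomial
    expressions.\<close>
  have "\<exists>a m. ?approx a m (1 / real (Suc k))" for k
    using polynomial_approx_interval[OF f, of "1 / real (Suc k)" C] by (metis of_nat_0_less_iff zero_less_Suc zero_less_divide_1_iff)
  then obtain as ms where approx: "\<And>k. ?approx (as k) (ms k) (1 / real (Suc k))" by metis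
  have lim_of_approx: "X \<longlonglongrightarrow> l" if "\<And>k. \<bar>l - X k\<bar> \<le> 1 / real (Suc k)" for X and l :: real
  proof (rule LIM_zero_cancel, rule Lim_null_comparison)
    show "\<forall>\<^sub>F k in sequentially. norm (X k - l) \<le> 1 / real (Suc k)"
      using that by (simp add: abs_minus_commute)
    show "(\<lambda>k. 1 / real (Suc k)) \<longlonglongrightarrow> 0" by (rule LIMSEQ_Suc[OF lim_const_over_n])
  qed

  have F_cont: "continuous_map (XG G) euclideanreal (F a m)" for a m
    unfolding F_def
  proof (intro continuous_map_sum continuous_map_real_mult_left)
    fix i
    have "continuous_map (XG G) euclidean (\<lambda>\<omega>. kpow (carrier G) (H \<omega>) i \<one>\<^bsub>G\<^esub> \<one>\<^bsub>G\<^esub>)"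
      by (rule continuous_kpow[OF op one_closed])
    moreover have "continuous_map euclidean euclideanreal Re" by (simp add: continuous_on_Re continuous_on_id)
    ultimately show "continuous_map (XG G) euclideanreal (\<lambda>\<omega>. Re (kpow (carrier G) (H \<omega>) i \<one>\<^bsub>G\<^esub> \<one>\<^bsub>G\<^esub>))"
      using continuous_map_compose unfolding o_def by blast
  qed simp
  have F_meas: "F a m \<in> borel_measurable \<mu>" for a m
    using continuous_map_XG_measurable[OF comp countable_carrier F_cont] by (simp cong: measurable_cong_sets add: sets_\<mu>)
  have theta_meas: "(\<lambda>\<omega>. theta G H \<omega> f) \<in> borel_measurable \<mu>"
  proof (rule borel_measurable_LIMSEQ_real)
    show "(\<lambda>k. F (as k) (ms k) \<omega>) \<longlonglongrightarrow> theta G H \<omega> f" if "\<omega> \<in> space \<mu>" for \<omega>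
      using that approx by (intro lim_of_approx theta_F) (auto simp: space_\<mu>)
  qed (rule F_meas)
  have T_meas: "T a m n \<in> borel_measurable (\<mu>s n)" for a m n
    unfolding T_def Fn_def
    using measurable_kpow_Hn[OF op fin perm weak assms(6)]
    by (intro borel_measurable_divide borel_measurable_sum borel_measurable_times borel_measurable_const
        measurable_compose[OF _ borel_measurable_Re]) (simp_all cong: measurable_cong_sets add: \<mu>s(2))
  have theta_n_meas: "(\<lambda>\<rho>. theta_n V Hn n \<rho> f) \<in> borel_measurable (\<mu>s n)" for n
  proof (rule borel_measurable_LIMSEQ_real)
    show "(\<lambda>k. T (as k) (ms k) n \<rho>) \<longlonglongrightarrow> theta_n V Hn n \<rho> f" if "\<rho> \<in> space (\<mu>s n)" for \<rho>
      using that approx by (intro lim_of_approx theta_n_T) (auto simp: space_\<mu>s)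
  qed (rule T_meas)

  \<comment> \<open>Error budget: replacing f by the polynomial costs \<epsilon> / 8 in
    \<open>theta_n\<close> and again in \<open>IDS\<close>; exceptional vertices and empirical
    convergence cost less than \<epsilon> / 4 each. The total stays below \<epsilon>.\<close>
  obtain a m where a: "?approx a m (\<epsilon> / 8)"
    using polynomial_approx_interval[OF f, of "\<epsilon> / 8" C] \<open>\<epsilon> > 0\<close> by (metis zero_less_divide_iff zero_less_numeral)
  define Q where "Q = (\<Sum>i\<le>m. \<bar>a i\<bar> * C ^ i)"
  have Q: "Q \<ge> 0" using C by (auto simp: Q_def intro!: sum_nonneg)
  have F_le: "\<bar>F a m \<omega>\<bar> \<le> Q" if "\<omega> \<in> topspace (XG G)" for \<omega>
    unfolding F_def Q_def
    by (rule order_trans[OF sum_abs], intro sum_mono, unfold abs_mult,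
        intro mult_left_mono banded_kernel.abs_Re_kpow_diag_le[OF bkG[OF that] one_closed C]) auto
  have Fn_le: "\<bar>Fn a m n \<rho> v\<bar> \<le> Q" if "\<rho> \<in> space (PiM (V n) (\<lambda>_. borel))" "v \<in> V n" for n \<rho> v
    unfolding Fn_def Q_def
    by (rule order_trans[OF sum_abs], intro sum_mono, unfold abs_mult,
        intro mult_left_mono banded_kernel.abs_Re_kpow_diag_le[OF bkV[OF that(1)] that(2) C]) auto

  have IDS_F: "\<bar>IDS G H \<mu> f - (\<integral>\<omega>. F a m \<omega> \<partial>\<mu>)\<bar> \<le> \<epsilon> / 8"
  proof -
    have intF: "integrable \<mu> (F a m)"
      using F_le by (intro \<mu>.integrable_const_bound[of _ Q] AE_I2 F_meas) (auto simp: space_\<mu>)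
    have le': "\<bar>theta G H \<omega> f - F a m \<omega>\<bar> \<le> \<epsilon> / 8" if "\<omega> \<in> space \<mu>" for \<omega>
      using that theta_F[OF _ a] by (simp add: space_\<mu>)
    \<comment> \<open>Integrability of \<open>theta\<close> is obtained as \<open>F a m\<close> plus
      a bounded measurable difference, which lets the integral in \<open>IDS\<close> be
      split.\<close>
    have intd: "integrable \<mu> (\<lambda>\<omega>. theta G H \<omega> f - F a m \<omega>)"
      using le' theta_meas F_meas by (intro \<mu>.integrable_const_bound[of _ "\<epsilon> / 8"] AE_I2) auto
    then have "integrable \<mu> (\<lambda>\<omega>. theta G H \<omega> f)"
      using Bochner_Integration.integrable_add[OF intd intF] by simp
    then have "IDS G H \<mu> f - (\<integral>\<omega>. F a m \<omega> \<partial>\<mu>) = (\<integral>\<omega>. theta G H \<omega> f - F a m \<omega> \<partial>\<mu>)"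
      using intF by (simp add: IDS_def)
    also have "\<bar>\<dots>\<bar> \<le> (\<integral>\<omega>. \<bar>theta G H \<omega> f - F a m \<omega>\<bar> \<partial>\<mu>)" by (rule integral_abs_bound)
    also have "\<dots> \<le> (\<integral>\<omega>. \<epsilon> / 8 \<partial>\<mu>)" using intd le' by (intro integral_mono) auto
    also have "\<dots> = \<epsilon> / 8" using \<mu>.prob_space by simp
    finally show ?thesis .
  qed

  \<comment> \<open>The radius required for the m-th power, which also serves all lower
    ones.\<close>
  define k where "k = 2 * (2 * Suc (4 * M) + m * M)"
  define r where "r n = real (card {v \<in> V n. nice V \<sigma> n k v}) / real (card (V n))" for n
  have r_lim: "r \<longlonglongrightarrow> 1" using almost_all_nice[OF sofic, of k] by (simp add: almost_all_def r_def[abs_def])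
  \<comment> \<open>Nice vertices contribute identical terms to both averages. The others form a
    fraction \<open>1 - r n\<close>, and each changes its term by at most 2 Q.\<close>
  have T_avg: "\<bar>T a m n \<rho> - (\<Sum>v\<in>V n. F a m (PiV G \<sigma> n v \<rho>)) / real (card (V n))\<bar> \<le> 2 * Q * (1 - r n)"
    if \<rho>: "\<rho> \<in> space (PiM (V n) (\<lambda>_. borel))" for n \<rho>
  proof (cases "V n = {}")
    case True
    then show ?thesis using Q by (simp add: T_def r_def)
  next
    case False
    let ?d = "\<lambda>v. Fn a m n \<rho> v - F a m (PiV G \<sigma> n v \<rho>)" and ?N = "{v \<in> V n. nice V \<sigma> n k v}"
    have card: "card (V n) > 0" using False fin by (simp add: card_gt_0_iff)
    have "?d v = 0" if "v \<in> ?N" for v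
    proof -
      have "kpow (V n) (Hn n \<rho>) i v v = kpow (carrier G) (H (PiV G \<sigma> n v \<rho>)) i \<one>\<^bsub>G\<^esub> \<one>\<^bsub>G\<^esub>" if "i \<le> m" for i
        using \<open>v \<in> ?N\<close> mult_right_mono[OF that, of M]
        by (intro kpow_Hn_diag_local[OF op fin perm weak assms(6) _ _ \<rho>, of k]) (auto simp: k_def)
      then show ?thesis by (simp add: Fn_def F_def)
    qed
    moreover have "\<bar>?d v\<bar> \<le> 2 * Q" if "v \<in> V n" for v
      using F_le[OF PiV_in_topspace[of \<sigma> n v \<rho>]] Fn_le[OF \<rho> that] by linarith
    ultimately have "\<bar>\<Sum>v\<in>V n. ?d v\<bar> \<le> (\<Sum>v\<in>V n. if v \<in> ?N then 0 else 2 * Q)"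
      by (intro order_trans[OF sum_abs] sum_mono) auto
    also have "\<dots> = (\<Sum>v\<in>V n - ?N. 2 * Q)"
      using fin by (intro sum.mono_neutral_cong_right) auto
    also have "\<dots> = 2 * Q * (real (card (V n)) - real (card ?N))"
      using fin card_mono[OF fin, of ?N n] by (simp add: card_Diff_subset of_nat_diff)
    finally have "\<bar>\<Sum>v\<in>V n. ?d v\<bar> / real (card (V n)) \<le> 2 * Q * (real (card (V n)) - real (card ?N)) / real (card (V n))"
      by (intro divide_right_mono) auto
    also have "\<dots> = 2 * Q * (1 - r n)"
      using card by (simp only: r_def times_divide_eq_right[symmetric] diff_divide_distrib) simp
    finally show ?thesis
      by (simp add: T_def sum_subtractf flip: diff_divide_distrib)
  qed

  define E where "E n = {\<rho> \<in> space (\<mu>s n). \<bar>theta_n V Hn n \<rho> f - IDS G H \<mu> f\<bar> < \<epsilon>}" for n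
  define E' where "E' n = {\<rho> \<in> space (\<mu>s n).
      \<bar>(\<Sum>v\<in>V n. F a m (PiV G \<sigma> n v \<rho>)) / real (card (V n)) - (\<integral>\<omega>. F a m \<omega> \<partial>\<mu>)\<bar> < \<epsilon> / 4}" for n
  \<comment> \<open>Comparing the measures of \<open>E' n\<close> and \<open>E n\<close> by
    inclusion requires the larger set to be measurable; this is where measurability of
    \<open>theta_n\<close> enters.\<close>
  have E_sets: "E n \<in> sets (\<mu>s n)" for n
    unfolding E_def using theta_n_meas[of n] by measurable
  have "(\<lambda>n. measure (\<mu>s n) {\<rho> \<in> space (\<mu>s n). \<forall>h\<in>{F a m}.
      \<bar>(\<Sum>v\<in>V n. h (PiV G \<sigma> n v \<rho>)) / real (card (V n)) - (\<integral>\<omega>. h \<omega> \<partial>\<mu>)\<bar> < \<epsilon> / 4}) \<longlonglongrightarrow> 1"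
    using le F_cont[of a m] \<open>\<epsilon> > 0\<close> unfolding loc_emp_def
    by (elim conjE allE[of _ "{F a m}"] allE[of _ "\<epsilon> / 4"] impE) auto
  then have E'_lim: "(\<lambda>n. measure (\<mu>s n) (E' n)) \<longlonglongrightarrow> 1" by (simp add: E'_def)
  have "(\<lambda>n. 2 * Q * (1 - r n)) \<longlonglongrightarrow> 2 * Q * (1 - 1)" by (intro tendsto_intros r_lim)
  then have "\<forall>\<^sub>F n in sequentially. 2 * Q * (1 - r n) < \<epsilon> / 4"
    using \<open>\<epsilon> > 0\<close> by (intro order_tendstoD) auto
  then have "\<forall>\<^sub>F n in sequentially. measure (\<mu>s n) (E' n) \<le> measure (\<mu>s n) (E n)"
  proof eventually_elim
    case (elim n)
    interpret prob_space "\<mu>s n" by (rule \<mu>s)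
    have "E' n \<subseteq> E n"
    proof
      fix \<rho> assume \<rho>: "\<rho> \<in> E' n"
      then have sp: "\<rho> \<in> space (PiM (V n) (\<lambda>_. borel))"
        and near: "\<bar>(\<Sum>v\<in>V n. F a m (PiV G \<sigma> n v \<rho>)) / real (card (V n)) - (\<integral>\<omega>. F a m \<omega> \<partial>\<mu>)\<bar> < \<epsilon> / 4"
        by (simp_all add: E'_def space_\<mu>s)
      have "\<bar>theta_n V Hn n \<rho> f - IDS G H \<mu> f\<bar> < \<epsilon>"
        using near elim theta_n_T[OF sp a] T_avg[OF sp] IDS_F \<open>\<epsilon> > 0\<close> by linarith
      then show "\<rho> \<in> E n" using sp by (simp add: E_def space_\<mu>s)
    qed
    then show ?case using E_sets by (rule finite_measure_mono)
  qed
  then have "(\<lambda>n. measure (\<mu>s n) (E n)) \<longlonglongrightarrow> 1"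
    using \<mu>s(1) by (intro tendsto_sandwich[OF _ _ E'_lim tendsto_const]) (auto simp: prob_space.prob_le_1)
  then show ?thesis by (simp add: E_def)
qed

end
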